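(* Let $X$ be a compact $\mathbb{R}$-tree. Then its magnitude is $|X|=1+\frac{\lambda(X)}{2}$, where $\lambda(X)\in[0,\infty]$ is its total length. In particular, $|X|=\infty$ when $\lambda(X)=\infty$.
   Context: An $\mathbb{R}$-tree is a uniquely geodesic metric space (any two points $x,y$ are joined by a unique segment $\llbracket x,y\rrbracket$, i.e. subset isometric to $[0,d(x,y)]$ with endpoints $x,y$) such that $\llbracket x,z\rrbracket\subseteq\llbracket x,y\rrbracket\cup\llbracket y,z\rrbracket$ for all $x,y,z$. Its skeleton is $\operatorname{Sk}(X)=\bigcup_{x,y\in X}\llbracket x,y\rrbracket\setminus\{x,y\}$, and the total length is $\lambda(X)=\mathscr{H}^1(\operatorname{Sk}(X))$ ($\mathscr{H}^1$ = one-dimensional Hausdorff measure). Compact $\mathbb{R}$-trees are of negative type ($(X,\sqrt d)$ embeds isometrically in a Hilbert space), so $\langle\mu,\nu\rangle_{\mathscr W}=\int\int e^{-d(x,y)}\mu(dx)\nu(dy)$ is an inner product on finite signed Borel measures, with norm $\|\cdot\|_{\mathscr W}$. The magnitude is $|X|=\sup\{1/\|\mu\|_{\mathscr W}^2:\mu \text{ finite signed Borel measure on }X,\ \mu(X)=1\}\in(0,\infty]$. *)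

theory Defs
  imports "HOL-Analysis.Analysis" "HOL-Probability.Probability"
begin

definition is_segment :: "'a::metric_space set \<Rightarrow> 'a \<Rightarrow> 'a \<Rightarrow> 'a set \<Rightarrow> bool" where
  "is_segment X x y S \<longleftrightarrow> S \<subseteq> X \<and>
     (\<exists>f. f ` {0..dist x y} = S \<and> f 0 = x \<and> f (dist x y) = y \<and>
          (\<forall>s\<in>{0..dist x y}. \<forall>t\<in>{0..dist x y}. dist (f s) (f t) = \<bar>s - t\<bar>))"

definition segment_in :: "'a::metric_space set \<Rightarrow> 'a \<Rightarrow> 'a \<Rightarrow> 'a set" where
  "segment_in X x y = (THE S. is_segment X x y S)"

definition uniquely_geodesic :: "'a::metric_space set \<Rightarrow> bool" where
  "uniquely_geodesic X \<longleftrightarrow> (\<forall>x\<in>X. \<forall>y\<in>X. \<exists>!S. is_segment X x y S)"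

definition is_R_tree :: "'a::metric_space set \<Rightarrow> bool" where
  "is_R_tree X \<longleftrightarrow> uniquely_geodesic X \<and>
     (\<forall>x\<in>X. \<forall>y\<in>X. \<forall>z\<in>X. segment_in X x z \<subseteq> segment_in X x y \<union> segment_in X y z)"

definition skeleton :: "'a::metric_space set \<Rightarrow> 'a set" where
  "skeleton X = (\<Union>x\<in>X. \<Union>y\<in>X. segment_in X x y - {x, y})"

definition ediam :: "'a::metric_space set \<Rightarrow> ennreal" where
  "ediam C = (SUP x\<in>C. SUP y\<in>C. ennreal (dist x y))"

definition hausdorff1_pre :: "real \<Rightarrow> 'a::metric_space set \<Rightarrow> ennreal" where
  "hausdorff1_pre \<delta> A = (INF C \<in> {C :: nat \<Rightarrow> 'a set. A \<subseteq> (\<Union>i. C i) \<and> (\<forall>i. ediam (C i) \<le> ennreal \<delta>)}.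
                            (\<Sum>i. ediam (C i)))"

definition hausdorff1 :: "'a::metric_space set \<Rightarrow> ennreal" where
  "hausdorff1 A = (SUP \<delta>\<in>{0<..}. hausdorff1_pre \<delta> A)"

definition total_length :: "'a::metric_space set \<Rightarrow> ennreal" where
  "total_length X = hausdorff1 (skeleton X)"

text \<open>A finite signed Borel measure on X is represented as P - N with P, N finite
  (positive) Borel measures on X (Jordan decomposition).\<close>
definition finite_borel_on :: "'a::metric_space set \<Rightarrow> 'a measure \<Rightarrow> bool" where
  "finite_borel_on X M \<longleftrightarrow> sets M = sets (restrict_space borel X) \<and> finite_measure M"

definition wprod :: "'a::metric_space measure \<Rightarrow> 'a measure \<Rightarrow> real" where
  "wprod M N = (\<integral>x. (\<integral>y. exp (- dist x y) \<partial>N) \<partial>M)"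

definition wnorm2 :: "'a::metric_space measure \<Rightarrow> 'a measure \<Rightarrow> real" where
  "wnorm2 P N = wprod P P - wprod P N - wprod N P + wprod N N"

definition magnitude :: "'a::metric_space set \<Rightarrow> ennreal" where
  "magnitude X = (SUP PN \<in> {(P, N). finite_borel_on X P \<and> finite_borel_on X N \<and>
                                   measure P X - measure N X = 1}.
                    ennreal (1 / wnorm2 (fst PN) (snd PN)))"

end

theory Submission
  imports Defs
begin

text \<open>
  If a point x is attached to a finite tree at the vertex p by an edge of length h, then the quadratic
  form of exp (- d) splits: moving the mass a of x to p, damped by the factor q = exp (- h), leaves the
  form on the smaller tree plus the square a^2 (1 - q^2). Attaching x therefore raises the magnitude
  by (1 - q) / (1 + q) = tanh (h / 2), which lies between (1 - h) h / 2 and h / 2. Hence a finite subset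
  of a tree whose edges have length at most delta and total length L has magnitude between
  1 + (1 - delta) L / 2 and 1 + L / 2. Measures on X are compared with weights on such finite
  subsets by moving all mass to a finite net. The length of X is the supremum of the lengths of its
  finitely generated subtrees: these exhaust the skeleton, and their edges, shortened a little, are
  at positive distance from each other, so Hausdorff premeasures at small scales add up over them.
\<close>

section \<open>Finite trees\<close>

text \<open>The number attached to a finite tree is its Cauchy-Schwarz constant: the least
  \<open>c\<close> with (sum of b)^2 \<le> c * energy of b for all weights b. One induction over the
  edges yields this inequality, a weight attaining it and the bounds on \<open>c\<close>, so the
  same \<open>c\<close> serves both halves of the theorem. The length \<open>L\<close> of a subtree
  is unchanged when its edges are subdivided; hence \<delta> may tend to 0 with \<open>L\<close>
  fixed, which removes the factor 1 - \<delta> from the lower bound. In the upper bound the cost of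
  moving mass by \<epsilon> is proportional to (P(X) + N(X))^2, which is not bounded over all
  admissible pairs; therefore \<epsilon> tends to 0 for each pair separately, before the supremum is
  taken.\<close>

definition exp_energy :: "'a::metric_space set \<Rightarrow> ('a \<Rightarrow> real) \<Rightarrow> real" where
  "exp_energy F a = (\<Sum>u\<in>F. \<Sum>v\<in>F. a u * a v * exp (- dist u v))"

text \<open>Only distances are recorded: a new leaf \<open>x\<close> sees every old point through
  \<open>p\<close>. No surrounding tree enters, so the estimates of this section hold for finite
  subsets of any metric space that arise in this way.\<close>

inductive finite_tree :: "real \<Rightarrow> 'a::metric_space set \<Rightarrow> real \<Rightarrow> bool" for \<delta> where
  single: "finite_tree \<delta> {x} 0"
| extend: "\<lbrakk>finite_tree \<delta> G L; p \<in> G; x \<notin> G; 0 < h; h \<le> \<delta>; \<And>y. y \<in> G \<Longrightarrow> dist x y = h + dist p y\<rbrakk>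
    \<Longrightarrow> finite_tree \<delta> (insert x G) (L + h)"

lemma finite_tree_finite: "finite_tree \<delta> F L \<Longrightarrow> finite F"
  by (induction rule: finite_tree.induct) auto

text \<open>On \<open>G\<close> the kernel row of \<open>x\<close> is \<open>q\<close> times the row
  of \<open>p\<close>. Mass t at \<open>x\<close> and mass t q at \<open>p\<close> thus interact
  alike with \<open>G\<close>; only their self-energies t^2 and t^2 q^2 differ.\<close>

lemma exp_energy_insert:
  assumes "finite G" "p \<in> G" "x \<notin> G" "\<And>y. y \<in> G \<Longrightarrow> dist x y = h + dist p y"
  shows "exp_energy (insert x G) a =
    exp_energy G (a(p := a p + a x * exp (- h))) + (a x)\<^sup>2 * (1 - (exp (- h))\<^sup>2)"
proof -
  define q where "q = exp (- h)"
  define w where "w u v = exp (- dist u v)" for u v :: 'a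
  define t where "t = a x"
  define S where "S = (\<Sum>v\<in>G. a v * w p v)"
  have wx: "w x v = q * w p v" if "v \<in> G" for v
    using assms(4)[OF that] by (simp add: w_def q_def exp_add [symmetric])
  have wsym: "w u v = w v u" for u v by (simp add: w_def dist_commute)
  have wxx: "w u u = 1" for u by (simp add: w_def)
  have L: "exp_energy (insert x G) a = t * t + 2 * t * q * S + (\<Sum>u\<in>G. \<Sum>v\<in>G. a u * a v * w u v)"
  proof -
    have "exp_energy (insert x G) a = (\<Sum>u\<in>insert x G. a u * a x * w u x + (\<Sum>v\<in>G. a u * a v * w u v))"
      unfolding exp_energy_def w_def[symmetric] using assms(1,3) by simp
    also have "\<dots> = t * t * w x x + (\<Sum>v\<in>G. a x * a v * w x v)
        + ((\<Sum>u\<in>G. a u * a x * w u x) + (\<Sum>u\<in>G. \<Sum>v\<in>G. a u * a v * w u v))"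
      using assms(1,3) by (simp add: sum.distrib t_def)
    also have "(\<Sum>u\<in>G. a u * a x * w u x) = (\<Sum>u\<in>G. a x * a u * w x u)"
      by (intro sum.cong) (auto simp: wsym mult_ac)
    also have "(\<Sum>v\<in>G. a x * a v * w x v) = t * q * S"
      unfolding S_def sum_distrib_left by (intro sum.cong) (auto simp: wx t_def)
    finally show ?thesis by (simp add: wxx)
  qed
  have R: "exp_energy G (a(p := a p + t * q)) =
      (\<Sum>u\<in>G. \<Sum>v\<in>G. a u * a v * w u v) + 2 * t * q * S + t * q * (t * q)"
  proof -
    define b where "b u = (if u = p then t * q else 0)" for u
    have eq: "a(p := a p + t * q) = (\<lambda>u. a u + b u)" by (auto simp: b_def)
    have "exp_energy G (a(p := a p + t * q)) =
       (\<Sum>u\<in>G. \<Sum>v\<in>G. a u * a v * w u v) + (\<Sum>u\<in>G. \<Sum>v\<in>G. a u * b v * w u v)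
       + ((\<Sum>u\<in>G. \<Sum>v\<in>G. b u * a v * w u v) + (\<Sum>u\<in>G. \<Sum>v\<in>G. b u * b v * w u v))"
      unfolding exp_energy_def eq w_def[symmetric]
      by (simp add: sum.distrib [symmetric] algebra_simps)
    moreover have "(\<Sum>u\<in>G. \<Sum>v\<in>G. b u * f v * w u v) = t * q * (\<Sum>v\<in>G. f v * w p v)" for f
    proof -
      have "(\<Sum>u\<in>G. \<Sum>v\<in>G. b u * f v * w u v) = (\<Sum>u\<in>G. b u * (\<Sum>v\<in>G. f v * w u v))"
        by (simp add: sum_distrib_left mult_ac)
      also have "\<dots> = (\<Sum>u\<in>G. if u = p then t * q * (\<Sum>v\<in>G. f v * w u v) else 0)"
        by (intro sum.cong) (auto simp: b_def)
      finally show ?thesis using assms(1,2) by simp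
    qed
    moreover have "(\<Sum>v\<in>G. b v * w p v) = t * q"
    proof -
      have "(\<Sum>v\<in>G. b v * w p v) = (\<Sum>v\<in>G. if v = p then t * q else 0)"
        by (intro sum.cong) (auto simp: b_def wxx)
      then show ?thesis using assms(1,2) by simp
    qed
    moreover have "(\<Sum>u\<in>G. \<Sum>v\<in>G. a u * b v * w u v) = (\<Sum>u\<in>G. \<Sum>v\<in>G. b u * a v * w u v)"
      by (subst sum.swap) (simp add: wsym mult_ac)
    ultimately show ?thesis by (simp add: S_def)
  qed
  show ?thesis
    unfolding L using R by (simp add: t_def q_def power2_eq_square algebra_simps)
qed

text \<open>This is s^2 / A + t^2 / B \<ge> (s + t)^2 / (A + B) with the denominators cleared. It
  makes the Cauchy-Schwarz constants add up when an edge is attached.\<close>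

lemma weighted_Cauchy_Schwarz:
  fixes s t A B E U :: real
  assumes "0 < A" "0 < B" "s\<^sup>2 \<le> A * E" "t\<^sup>2 \<le> B * U"
  shows "(s + t)\<^sup>2 \<le> (A + B) * (E + U)"
proof -
  have *: "A * B * (2 * s * t) \<le> A * A * t\<^sup>2 + B * B * s\<^sup>2"
    using zero_le_power2[of "A * t - B * s"] by (simp add: power2_eq_square algebra_simps)
  have "A * B * (2 * s * t) \<le> A * A * (B * U) + B * B * (A * E)"
    using * mult_left_mono[OF assms(4), of "A * A"] mult_left_mono[OF assms(3), of "B * B"] by auto
  also have "\<dots> = A * B * (A * U + B * E)" by (simp add: algebra_simps)
  finally have "2 * s * t \<le> A * U + B * E" using assms(1,2) by simp
  with assms(3,4) show ?thesis by (simp add: power2_eq_square algebra_simps)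
qed

text \<open>Everything comes from exp t \<ge> 1 + t. For the upper bound, h (1 + q) - 2 (1 - q)
  vanishes at 0 and has derivative 1 - (1 + h) q \<ge> 0. For the lower bound, (1 - h) h \<le> h q
  \<le> 1 - q, and 1 + q \<le> 2.\<close>

lemma tanh_half_bounds:
  fixes h :: real
  assumes "0 < h" "h \<le> \<delta>"
  defines "q \<equiv> exp (- h)"
  shows "(1 - \<delta>) * h / 2 \<le> (1 - q) / (1 + q)" "(1 - q) / (1 + q) \<le> h / 2"
proof -
  have q: "0 < q" "q < 1" using assms by (auto simp: q_def)
  have der: "((\<lambda>h. h * (1 + exp (- h)) - 2 * (1 - exp (- h))) has_real_derivative
      (1 - exp (- x) - x * exp (- x))) (at x)" for x :: real
    by (auto intro!: derivative_eq_intros simp: algebra_simps)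
  have "1 - exp (- x) - x * exp (- x) \<ge> 0" if "x \<ge> 0" for x :: real
  proof -
    have "(1 + x) * exp (- x) \<le> exp x * exp (- x)"
      by (intro mult_right_mono exp_ge_add_one_self) auto
    then show ?thesis by (simp add: exp_minus algebra_simps)
  qed
  then have nonneg: "\<exists>y. ((\<lambda>h. h * (1 + exp (- h)) - 2 * (1 - exp (- h))) has_real_derivative y) (at x) \<and> 0 \<le> y"
    if "0 \<le> x" for x :: real using der that by metis
  have "(\<lambda>h. h * (1 + exp (- h)) - 2 * (1 - exp (- h))) 0
      \<le> (\<lambda>h. h * (1 + exp (- h)) - 2 * (1 - exp (- h))) h"
    by (rule DERIV_nonneg_imp_nondecreasing) (use assms(1) nonneg in auto)
  then have "2 * (1 - q) \<le> h * (1 + q)" by (simp add: q_def)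
  then show "(1 - q) / (1 + q) \<le> h / 2"
    using q by (simp add: divide_simps mult.commute)
  have "q * (1 + h) \<le> q * exp h" using q by (intro mult_left_mono exp_ge_add_one_self) auto
  then have q1: "q * (1 + h) \<le> 1" by (simp add: q_def exp_minus)
  show "(1 - \<delta>) * h / 2 \<le> (1 - q) / (1 + q)"
  proof (cases "\<delta> \<le> 1")
    case False
    then have "(1 - \<delta>) * h / 2 \<le> 0" using assms(1) by (simp add: mult_le_0_iff)
    also have "\<dots> \<le> (1 - q) / (1 + q)" using q by simp
    finally show ?thesis .
  next
    case True
    have "(1 - \<delta>) * h \<le> (1 - h) * h" using assms by (intro mult_right_mono) auto
    also have "\<dots> \<le> h * q"
    proof -
      have "1 - h \<le> q" using exp_ge_add_one_self[of "- h"] by (simp add: q_def)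
      then show ?thesis using assms(1) by (simp add: mult.commute mult_left_mono)
    qed
    also have "\<dots> \<le> 1 - q" using q1 by (simp add: algebra_simps)
    finally have "(1 - \<delta>) * h / 2 \<le> (1 - q) / 2" by simp
    also have "\<dots> \<le> (1 - q) / (1 + q)" using q by (intro divide_left_mono) auto
    finally show ?thesis .
  qed
qed

text \<open>The constant \<open>c\<close> grows by B = tanh (h / 2) per edge, since mass and energy
  both split into a part on \<open>G\<close> and a part depending on the mass at \<open>x\<close>
  alone. The attaining weight is normalized so that its mass and its energy are both
  \<open>c\<close>.\<close>

lemma finite_tree_weighting:
  assumes "finite_tree \<delta> F L"
  shows "\<exists>c. 1 + (1 - \<delta>) * L / 2 \<le> c \<and> c \<le> 1 + L / 2 \<and> 0 < c \<and>
    (\<exists>a. sum a F = c \<and> exp_energy F a = c) \<and>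
    (\<forall>b. (sum b F)\<^sup>2 \<le> c * exp_energy F b)"
  using assms
proof (induction rule: finite_tree.induct)
  case (single x)
  show ?case
    by (rule exI[of _ 1]) (auto simp: exp_energy_def power2_eq_square intro!: exI[of _ "\<lambda>_. 1"])
next
  case (extend G L p x h)
  define q where "q = exp (- h)"
  define B where "B = (1 - q) / (1 + q)"
  have fin: "finite G" using extend finite_tree_finite by blast
  have q: "0 < q" "q < 1" using extend by (auto simp: q_def)
  have B: "0 < B" using q by (simp add: B_def)
  have energy: "exp_energy (insert x G) b =
      exp_energy G (b(p := b p + b x * q)) + (b x)\<^sup>2 * (1 - q\<^sup>2)" for b
    using exp_energy_insert[of G p x h b] fin extend by (simp add: q_def)
  \<comment> \<open>Damping loses the fraction 1 - q of the mass at \<open>x\<close>; this loss is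
    the new summand.\<close>
  have total: "sum b (insert x G) = sum (b(p := b p + b x * q)) G + b x * (1 - q)" for b
  proof -
    have "sum (b(p := b p + b x * q)) G = sum b G + b x * q"
      using fin extend(2) by (simp add: sum.remove[of _ p])
    then show ?thesis using fin extend(3) by (simp add: algebra_simps)
  qed
  obtain c a where c: "1 + (1 - \<delta>) * L / 2 \<le> c" "c \<le> 1 + L / 2" "0 < c"
    and a: "sum a G = c" "exp_energy G a = c"
    and b: "\<And>b. (sum b G)\<^sup>2 \<le> c * exp_energy G b"
    using extend.IH by blast
  \<comment> \<open>The Cauchy-Schwarz inequality of a single edge, with equality; this identity
    determines \<open>B\<close>.\<close>
  have "(1 - q)\<^sup>2 = B * (1 - q\<^sup>2)" using q by (simp add: B_def power2_eq_square field_simps)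
  then have sq: "(t * (1 - q))\<^sup>2 = B * (t\<^sup>2 * (1 - q\<^sup>2))" for t
    by (simp add: power_mult_distrib)
  show ?case
  proof (intro exI[of _ "c + B"] conjI allI)
    show "1 + (1 - \<delta>) * (L + h) / 2 \<le> c + B" "c + B \<le> 1 + (L + h) / 2"
      using c tanh_half_bounds[of h \<delta>] extend by (auto simp: B_def q_def algebra_simps add_divide_distrib diff_divide_distrib)
    show "0 < c + B" using c B by simp
    \<comment> \<open>With this \<open>t\<close> the lost mass t (1 - q) and the extra energy t^2 (1
      - q^2) are both \<open>B\<close>. Subtracting t q at \<open>p\<close> ensures that the damped
      transfer from \<open>x\<close> gives back the old optimal weight \<open>a\<close>.\<close>
    define t where "t = 1 / (1 + q)"
    define a' where "a' = a(p := a p - t * q, x := t)"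
    have px: "p \<noteq> x" using extend by auto
    have "sum (a'(p := a' p + a' x * q)) G = c"
      unfolding a(1)[symmetric] using px extend(3) by (intro sum.cong) (auto simp: a'_def)
    moreover have "exp_energy G (a'(p := a' p + a' x * q)) = c"
      unfolding a(2)[symmetric] exp_energy_def using px extend(3)
      by (intro sum.cong) (auto simp: a'_def)
    moreover have "a' x = t" by (simp add: a'_def)
    moreover have "t * (1 - q) = B" "t\<^sup>2 * (1 - q\<^sup>2) = B"
      using q by (auto simp: t_def B_def power2_eq_square divide_simps) (simp add: algebra_simps)
    ultimately show "\<exists>a. sum a (insert x G) = c + B \<and> exp_energy (insert x G) a = c + B"
      by (intro exI[of _ a']) (simp only: total energy)
    show "(sum b (insert x G))\<^sup>2 \<le> (c + B) * exp_energy (insert x G) b" for b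
      unfolding total energy
      by (rule weighted_Cauchy_Schwarz[OF c(3) B b]) (simp add: sq)
  qed
qed

section \<open>Segments and subtrees\<close>

locale R_tree =
  fixes X :: "'a::metric_space set"
  assumes nonempty: "X \<noteq> {}" and compact: "compact X" and R_tree: "is_R_tree X"
begin

lemma is_segment_segment_in:
  assumes "x \<in> X" "y \<in> X"
  shows "is_segment X x y (segment_in X x y)"
proof -
  have "\<exists>!S. is_segment X x y S"
    using R_tree assms by (auto simp: is_R_tree_def uniquely_geodesic_def)
  then show ?thesis unfolding segment_in_def by (rule theI')
qed

lemma segment_in_subset_Un:
  "\<lbrakk>x \<in> X; y \<in> X; z \<in> X\<rbrakk> \<Longrightarrow> segment_in X x z \<subseteq> segment_in X x y \<union> segment_in X y z"
  using R_tree by (auto simp: is_R_tree_def)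

lemma segment_parametrization:
  assumes "x \<in> X" "y \<in> X"
  obtains f where "f ` {0..dist x y} = segment_in X x y" "f 0 = x" "f (dist x y) = y"
    "\<And>s t. s \<in> {0..dist x y} \<Longrightarrow> t \<in> {0..dist x y} \<Longrightarrow> dist (f s) (f t) = \<bar>s - t\<bar>"
  using is_segment_segment_in[OF assms] unfolding is_segment_def by blast

lemma segment_in_between:
  assumes "x \<in> X" "y \<in> X" "z \<in> segment_in X x y"
  shows "z \<in> X \<and> dist x z + dist z y = dist x y"
proof -
  obtain f where f: "f ` {0..dist x y} = segment_in X x y" "f 0 = x" "f (dist x y) = y"
    "\<And>s t. s \<in> {0..dist x y} \<Longrightarrow> t \<in> {0..dist x y} \<Longrightarrow> dist (f s) (f t) = \<bar>s - t\<bar>"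
    using segment_parametrization assms by metis
  obtain t where t: "t \<in> {0..dist x y}" "z = f t" using assms(3) f(1) by blast
  have "dist x z = t" "dist z y = dist x y - t"
    using f(4)[of 0 t] f(4)[of t "dist x y"] f(2,3) t by auto
  moreover have "z \<in> X"
    using is_segment_segment_in[OF assms(1,2)] assms(3) by (auto simp: is_segment_def)
  ultimately show ?thesis by simp
qed

lemma segment_in_unique_point:
  assumes "x \<in> X" "y \<in> X" "z \<in> segment_in X x y" "w \<in> segment_in X x y" "dist x z = dist x w"
  shows "z = w"
proof -
  obtain f where f: "f ` {0..dist x y} = segment_in X x y" "f 0 = x" "f (dist x y) = y"
    "\<And>s t. s \<in> {0..dist x y} \<Longrightarrow> t \<in> {0..dist x y} \<Longrightarrow> dist (f s) (f t) = \<bar>s - t\<bar>"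
    using segment_parametrization assms by metis
  obtain s t where st: "s \<in> {0..dist x y}" "z = f s" "t \<in> {0..dist x y}" "w = f t"
    using assms(3,4) f(1) by blast
  then have "s = t" using f(4)[of 0 s] f(4)[of 0 t] f(2) assms(5) by auto
  then show ?thesis using st by simp
qed

text \<open>Let w be the point of [x, y] at distance d(x, z) from x. By the tree condition w lies on
  [x, z] or on [z, y], and in both cases its distances force w = z. Segments thereby become metric
  betweenness, and later arguments reduce to arithmetic with distances.\<close>

lemma segment_in_eq:
  assumes "x \<in> X" "y \<in> X"
  shows "segment_in X x y = {z \<in> X. dist x z + dist z y = dist x y}"
proof (intro equalityI subsetI)
  fix z assume "z \<in> {z \<in> X. dist x z + dist z y = dist x y}"
  then have z: "z \<in> X" "dist x z + dist z y = dist x y" by auto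
  obtain f where f: "f ` {0..dist x y} = segment_in X x y" "f 0 = x" "f (dist x y) = y"
    "\<And>s t. s \<in> {0..dist x y} \<Longrightarrow> t \<in> {0..dist x y} \<Longrightarrow> dist (f s) (f t) = \<bar>s - t\<bar>"
    using segment_parametrization assms by metis
  define w where "w = f (dist x z)"
  have "dist x z \<le> dist x y" using z(2) zero_le_dist[of z y] by linarith
  then have le: "dist x z \<in> {0..dist x y}" by simp
  have w: "w \<in> segment_in X x y" "dist x w = dist x z" "dist w y = dist z y"
    using f(1) f(4)[of 0 "dist x z"] f(4)[of "dist x z" "dist x y"] f(2,3) le z(2)
    by (auto simp: w_def)
  obtain g h where g: "g ` {0..dist x z} = segment_in X x z" "g (dist x z) = z"
    and h: "h ` {0..dist z y} = segment_in X z y" "h 0 = z"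
    using segment_parametrization assms z(1) by metis
  have "z \<in> segment_in X x z" using g by (metis atLeastAtMost_iff imageI order_refl zero_le_dist)
  moreover have "z \<in> segment_in X z y" using h by (metis atLeastAtMost_iff imageI order_refl zero_le_dist)
  moreover have "w \<in> segment_in X x z \<or> w \<in> segment_in X z y"
    using segment_in_subset_Un[of x z y] assms z(1) w(1) by blast
  ultimately consider "w \<in> segment_in X x z" "z \<in> segment_in X x z"
    | "w \<in> segment_in X z y" "z \<in> segment_in X z y" by blast
  then have "w = z"
  proof cases
    case 1
    then show ?thesis using segment_in_unique_point[of x z w z] assms z w by auto
  next
    case 2
    then have "dist z w + dist w y = dist z y" using segment_in_between assms z by blast
    then show ?thesis using w by simp
  qed
  then show "z \<in> segment_in X x y" using w by simp
next
  fix z assume "z \<in> segment_in X x y"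
  then show "z \<in> {z \<in> X. dist x z + dist z y = dist x y}"
    using segment_in_between assms by blast
qed

lemma segment_in_subset: "x \<in> X \<Longrightarrow> y \<in> X \<Longrightarrow> segment_in X x y \<subseteq> X"
  by (auto simp: segment_in_eq)

lemma between_cases:
  assumes "x \<in> X" "y \<in> X" "z \<in> X" "w \<in> X" "dist x w + dist w z = dist x z"
  shows "dist x w + dist w y = dist x y \<or> dist y w + dist w z = dist y z"
  using segment_in_subset_Un[of x y z] assms by (auto simp: segment_in_eq)

lemma segment_in_commute: "x \<in> X \<Longrightarrow> y \<in> X \<Longrightarrow> segment_in X x y = segment_in X y x"
  by (auto simp: segment_in_eq dist_commute add.commute)

lemma segment_in_self: "x \<in> X \<Longrightarrow> segment_in X x x = {x}"
  by (auto simp: segment_in_eq dist_commute)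

lemma ends_in_segment:
  "x \<in> X \<Longrightarrow> y \<in> X \<Longrightarrow> x \<in> segment_in X x y" "x \<in> X \<Longrightarrow> y \<in> X \<Longrightarrow> y \<in> segment_in X x y"
  by (auto simp: segment_in_eq)

text \<open>A point between f s and f t has, by the triangle inequality, distances to x and y adding
  up to at most d(x, y), so it is between x and y as well.\<close>

lemma subsegment:
  assumes "x \<in> X" "y \<in> X" "z \<in> segment_in X x y" "w \<in> segment_in X x y"
  shows "segment_in X z w \<subseteq> segment_in X x y"
proof -
  obtain f where f: "f ` {0..dist x y} = segment_in X x y" "f 0 = x" "f (dist x y) = y"
    "\<And>s t. s \<in> {0..dist x y} \<Longrightarrow> t \<in> {0..dist x y} \<Longrightarrow> dist (f s) (f t) = \<bar>s - t\<bar>"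
    using segment_parametrization assms by metis
  have *: "segment_in X (f s) (f t) \<subseteq> segment_in X x y" if "s \<le> t" "s \<in> {0..dist x y}" "t \<in> {0..dist x y}" for s t
  proof
    have X: "f s \<in> X" "f t \<in> X" using that f(1) segment_in_subset[OF assms(1,2)] by blast+
    fix v assume "v \<in> segment_in X (f s) (f t)"
    then have v: "v \<in> X" "dist (f s) v + dist v (f t) = t - s"
      using that X f(4)[of s t] by (auto simp: segment_in_eq)
    have "dist x (f s) = s" "dist (f t) y = dist x y - t"
      using f(4)[of 0 s] f(4)[of t "dist x y"] f(2,3) that by auto
    then have "dist x v + dist v y \<le> dist x y"
      using v dist_triangle[of x v "f s"] dist_triangle[of v y "f t"] by auto
    then show "v \<in> segment_in X x y"
      using v assms dist_triangle[of x y v] by (auto simp: segment_in_eq)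
  qed
  obtain s t where st: "s \<in> {0..dist x y}" "z = f s" "t \<in> {0..dist x y}" "w = f t"
    using assms(3,4) f(1) by blast
  then have "z \<in> X" "w \<in> X" using assms segment_in_subset by blast+
  then show ?thesis
    using *[of s t] *[of t s] st segment_in_commute[of z w] by (cases "s \<le> t") auto
qed

lemma compact_segment_in:
  assumes "x \<in> X" "y \<in> X"
  shows "compact (segment_in X x y)"
proof -
  have "segment_in X x y = X \<inter> {z. dist x z + dist z y = dist x y}"
    using assms by (auto simp: segment_in_eq)
  moreover have "closed {z. dist x z + dist z y = dist x y}"
    by (intro closed_Collect_eq continuous_intros)
  ultimately show ?thesis using compact by (simp add: compact_Int_closed)
qed

section \<open>Nearest points and subtrees grown by grafting segments\<close>

definition gate :: "'a set \<Rightarrow> 'a \<Rightarrow> 'a" where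
  "gate T x = (SOME p. p \<in> T \<and> (\<forall>y\<in>T. dist x p \<le> dist x y))"

text \<open>Grafting at the nearest point makes the new segment meet \<open>T\<close> only there, so
  lengths add. A point \<open>x\<close> already in \<open>T\<close> is allowed: its gate is
  \<open>x\<close> itself, and a degenerate segment of length 0 is grafted.\<close>

inductive subtree :: "'a set \<Rightarrow> real \<Rightarrow> bool" where
  point: "x \<in> X \<Longrightarrow> subtree {x} 0"
| graft: "subtree T L \<Longrightarrow> x \<in> X \<Longrightarrow> subtree (T \<union> segment_in X (gate T x) x) (L + dist (gate T x) x)"

lemma gate_nearest:
  assumes "compact T" "T \<noteq> {}"
  shows "gate T x \<in> T" "y \<in> T \<Longrightarrow> dist x (gate T x) \<le> dist x y"
proof -
  have "\<exists>p. p \<in> T \<and> (\<forall>y\<in>T. dist x p \<le> dist x y)"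
    using continuous_attains_inf[OF assms, of "dist x"] continuous_on_dist[OF continuous_on_const continuous_on_id]
    by auto
  then have "gate T x \<in> T \<and> (\<forall>y\<in>T. dist x (gate T x) \<le> dist x y)"
    unfolding gate_def by (rule someI_ex)
  then show "gate T x \<in> T" "y \<in> T \<Longrightarrow> dist x (gate T x) \<le> dist x y" by auto
qed

text \<open>Every point of [p, y] other than p lies in T and so, p being the point of T nearest to x, not in
  [p, x]; hence it lies in [x, y]. Letting it tend to p puts p on [x, y].\<close>

lemma dist_through_gate:
  assumes "compact T" "T \<subseteq> X" "\<And>y z. y \<in> T \<Longrightarrow> z \<in> T \<Longrightarrow> segment_in X y z \<subseteq> T"
    and "x \<in> X" "y \<in> T" "z \<in> segment_in X (gate T x) x"
  shows "dist z y = dist (gate T x) z + dist (gate T x) y"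
proof -
  define p where "p = gate T x"
  have p: "p \<in> T" "\<And>y. y \<in> T \<Longrightarrow> dist x p \<le> dist x y"
    using gate_nearest[OF assms(1)] assms(5) by (auto simp: p_def)
  have X: "p \<in> X" "y \<in> X" using p assms by auto
  obtain f where f: "f ` {0..dist p y} = segment_in X p y" "f 0 = p" "f (dist p y) = y"
    "\<And>s t. s \<in> {0..dist p y} \<Longrightarrow> t \<in> {0..dist p y} \<Longrightarrow> dist (f s) (f t) = \<bar>s - t\<bar>"
    using segment_parametrization X by metis
  have near: "dist p x + dist p y \<le> dist x y + 2 * s" if "0 < s" "s \<le> dist p y" for s
  proof -
    have w: "f s \<in> segment_in X p y" using f(1) that by auto
    then have wT: "f s \<in> T" using assms(3,5) p(1) by blast
    have ps: "dist p (f s) = s" using f(4)[of 0 s] f(2) that by auto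
    have "\<not> dist p (f s) + dist (f s) x = dist p x"
      using p(2)[OF wT] ps that by (auto simp: dist_commute)
    then have "dist x (f s) + dist (f s) y = dist x y"
      using between_cases[of p x y "f s"] w X assms(4) by (auto simp: segment_in_eq)
    then show ?thesis
      using dist_triangle[of p x "f s"] dist_triangle[of p y "f s"] ps by (auto simp: dist_commute)
  qed
  have "dist p x + dist p y \<le> dist x y"
  proof (cases "y = p")
    case False
    then have pos: "0 < dist p y" by simp
    show ?thesis
    proof (rule field_le_epsilon)
      fix e :: real assume "0 < e"
      then show "dist p x + dist p y \<le> dist x y + e"
        using near[of "min (e / 2) (dist p y)"] pos by auto
    qed
  qed (simp add: dist_commute)
  moreover have "dist p z + dist z x = dist p x"
    using assms(4,6) X by (simp add: segment_in_eq p_def)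
  ultimately show ?thesis
    using dist_triangle[of x y z] dist_triangle[of z y p]
    unfolding p_def[symmetric] by (auto simp: dist_commute)
qed

text \<open>Convexity survives grafting because a segment from \<open>T\<close> to the new edge is
  covered by two segments meeting at the gate, one inside \<open>T\<close> and one inside the
  edge.\<close>

lemma subtree_basic:
  assumes "subtree T L"
  shows "T \<noteq> {} \<and> compact T \<and> T \<subseteq> X \<and> (\<forall>y\<in>T. \<forall>z\<in>T. segment_in X y z \<subseteq> T)"
  using assms
proof (induction rule: subtree.induct)
  case (point x)
  then show ?case by (simp add: segment_in_self)
next
  case (graft T L x)
  define p where "p = gate T x"
  define S where "S = segment_in X p x"
  have p: "p \<in> T" "p \<in> X" using gate_nearest[of T x] graft by (auto simp: p_def)
  have S: "compact S" "S \<subseteq> X" "p \<in> S"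
    using p graft compact_segment_in segment_in_subset ends_in_segment by (auto simp: S_def)
  have SS: "segment_in X y z \<subseteq> S" if "y \<in> S" "z \<in> S" for y z
    using that subsegment p graft by (auto simp: S_def)
  have ST: "segment_in X y z \<subseteq> T \<union> S" if "y \<in> T" "z \<in> S" for y z
  proof -
    have "segment_in X y z \<subseteq> segment_in X y p \<union> segment_in X p z"
      using that p graft S by (intro segment_in_subset_Un) auto
    then show ?thesis using SS[of p z] that S p graft by blast
  qed
  have TS: "segment_in X z y \<subseteq> T \<union> S" if "y \<in> T" "z \<in> S" for y z
    using ST[OF that] that S(2) graft segment_in_commute[of z y] by blast
  have "segment_in X y z \<subseteq> T \<union> S" if "y \<in> T \<union> S" "z \<in> T \<union> S" for y z
    using that SS ST TS graft by blast
  then show ?case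
    using graft S unfolding p_def[symmetric] S_def[symmetric] by (auto intro: compact_Un)
qed

lemmas subtree_subset = subtree_basic[THEN conjunct2, THEN conjunct2, THEN conjunct1]

lemma subtree_gate:
  assumes "subtree T L"
  shows "gate T x \<in> T" "gate T x \<in> X"
  using gate_nearest[of T x] subtree_basic[OF assms] by auto

lemma subtree_dist_through_gate:
  assumes "subtree T L" "x \<in> X" "y \<in> T" "z \<in> segment_in X (gate T x) x"
  shows "dist z y = dist (gate T x) z + dist (gate T x) y"
  using dist_through_gate[of T x y z] subtree_basic[OF assms(1)] assms(2-) by blast

lemma subtree_containing_finite:
  assumes "finite A" "A \<subseteq> X"
  shows "\<exists>T L. subtree T L \<and> A \<subseteq> T"
  using assms
proof (induction rule: finite_induct)
  case empty
  then show ?case using nonempty point by blast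
next
  case (insert x A)
  then obtain T L where T: "subtree T L" "A \<subseteq> T" by auto
  have "x \<in> segment_in X (gate T x) x"
    using insert subtree_gate[OF T(1)] ends_in_segment by blast
  then show ?case using T graft[OF T(1), of x] insert by blast
qed

text \<open>The mesh points of \<open>D\<close>, distances from \<open>p\<close> along the edge, are
  attached in increasing order, each to its predecessor \<open>m\<close> or to \<open>p\<close> =
  \<open>f 0\<close>. The steps telescope to the largest element of \<open>D\<close>.\<close>

lemma finite_tree_on_edge:
  assumes tree: "finite_tree \<delta> G L" and G: "G \<subseteq> T" "p \<in> G" and T: "subtree T L'"
    and x: "x \<in> X" and p: "p = gate T x"
    and f: "f ` {0..dist p x} = segment_in X p x" "f 0 = p"
      "\<And>s t. s \<in> {0..dist p x} \<Longrightarrow> t \<in> {0..dist p x} \<Longrightarrow> dist (f s) (f t) = \<bar>s - t\<bar>"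
    and D: "finite D" "D \<subseteq> {0<..dist p x}"
      "\<And>t. t \<in> D \<Longrightarrow> \<exists>s\<in>insert 0 D. s < t \<and> t \<le> s + \<delta>"
  shows "finite_tree \<delta> (G \<union> f ` D) (L + Max (insert 0 D))"
  using D
proof (induction rule: finite_linorder_max_induct)
  case empty
  then show ?case using tree by simp
next
  case (insert b D)
  define m where "m = Max (insert 0 D)"
  have m: "m \<in> insert 0 D" using insert.hyps unfolding m_def by (intro Max_in) auto
  have m_max: "s \<le> m" if "s \<in> insert 0 D" for s using that insert.hyps by (simp add: m_def)
  have b: "0 < b" "b \<le> dist p x" using insert.prems by auto
  have mb: "m < b" using m insert.hyps b by auto
  have D0: "s \<in> {0..dist p x}" if "s \<in> insert 0 D" for s
    using that insert.prems(1) by (fastforce simp: less_imp_le)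
  have fm: "f m \<in> G \<union> f ` D" using m f(2) G by auto
  have IH: "finite_tree \<delta> (G \<union> f ` D) (L + m)"
    unfolding m_def
  proof (rule insert.IH)
    show "D \<subseteq> {0<..dist p x}" using insert.prems by auto
    \<comment> \<open>The mesh condition passes to the smaller set: the predecessor of t lies below
      t < b, so it is not b.\<close>
    fix t assume t: "t \<in> D"
    then have "t < b" using insert.hyps by auto
    then show "\<exists>s\<in>insert 0 D. s < t \<and> t \<le> s + \<delta>" using insert.prems(2)[of t] t by auto
  qed
  have far: "dist (f s) y = s + dist p y" if "y \<in> G" "s \<in> {0..dist p x}" for s y
  proof -
    have "f s \<in> segment_in X p x" using f(1) that by blast
    then have "dist (f s) y = dist p (f s) + dist p y"
      using subtree_dist_through_gate[OF T x, of y "f s"] that G p by auto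
    moreover have "dist p (f s) = s" using f(3)[of 0 s] f(2) that by auto
    ultimately show ?thesis by simp
  qed
  have new: "dist (f b) y = (b - m) + dist (f m) y" if "y \<in> G \<union> f ` D" for y
    using that
  proof
    assume "y \<in> G" then show ?thesis using far[of y b] far[of y m] b D0[OF m] by auto
  next
    assume "y \<in> f ` D"
    then obtain s where s: "s \<in> D" "y = f s" by auto
    then show ?thesis
      using f(3)[of b s] f(3)[of m s] b D0[OF m] D0[of s] m_max[of s] mb by auto
  qed
  have notin: "f b \<notin> G \<union> f ` D"
    proof
    assume "f b \<in> G \<union> f ` D"
    from new[OF this] show False using mb zero_le_dist[of "f m" "f b"] by simp
  qed
  obtain s where "s \<in> insert 0 (insert b D)" "s < b" "b \<le> s + \<delta>" using insert.prems(2)[of b] by blast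
  then have "b - m \<le> \<delta>" using m_max[of s] by auto
  then have "finite_tree \<delta> (insert (f b) (G \<union> f ` D)) (L + m + (b - m))"
    using mb by (intro finite_tree.extend[OF IH fm notin] new) auto
  moreover have "Max (insert 0 (insert b D)) = b"
    using insert.hyps b by (intro Max_eqI) auto
  ultimately show ?case by simp
qed

text \<open>The prescribed set \<open>S\<close> has two uses: it lets a net be included in the
  finite tree, and it lets the induction demand that the next gate be a vertex, so that the new edge
  can be attached there.\<close>

lemma subtree_finite_tree:
  assumes "subtree T L" "finite S" "0 < \<delta>"
  shows "\<exists>F. S \<inter> T \<subseteq> F \<and> F \<subseteq> T \<and> finite_tree \<delta> F L"
  using assms(1,2)
proof (induction arbitrary: S rule: subtree.induct)
  case (point x)
  then show ?case by (intro exI[of _ "{x}"]) (auto intro: finite_tree.single)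
next
  case (graft T L x)
  define p where "p = gate T x"
  have p: "p \<in> T" "p \<in> X" using subtree_gate[OF graft(1)] by (auto simp: p_def)
  obtain G where G: "insert p S \<inter> T \<subseteq> G" "G \<subseteq> T" "finite_tree \<delta> G L"
    using graft.IH[of "insert p S"] graft.prems by auto
  define h where "h = dist p x"
  obtain f where f: "f ` {0..dist p x} = segment_in X p x" "f 0 = p" "f (dist p x) = x"
    "\<And>s t. s \<in> {0..dist p x} \<Longrightarrow> t \<in> {0..dist p x} \<Longrightarrow> dist (f s) (f t) = \<bar>s - t\<bar>"
    using segment_parametrization p graft(2) by metis
  show ?case
  proof (cases "h = 0")
    case True
    then have "x = p" by (simp add: h_def)
    then have "segment_in X (gate T x) x = {p}" "dist (gate T x) x = 0"
      unfolding p_def[symmetric] using p segment_in_self[of p] by simp_all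
    then show ?thesis using G p by (intro exI[of _ G]) auto
  next
    case False
    then have h: "0 < h" by (simp add: h_def)
    obtain N :: nat where N: "h / \<delta> < real N" using reals_Archimedean2 by blast
    then have N0: "0 < N" using h assms(3) by (metis divide_pos_pos gr0I less_asym of_nat_0)
    have step: "h / N \<le> \<delta>" using N N0 assms(3) by (simp add: field_simps)
    \<comment> \<open>The points of \<open>S\<close> on the new edge together with a grid of step h
      / N \<le> \<delta>. The value 0 is removed because it stands for \<open>p\<close>, which is
      already a vertex; the value h is kept, so the whole edge length is counted.\<close>
    define D where "D = (dist p ` (S \<inter> segment_in X p x) \<union> (\<lambda>k. real k * h / N) ` {1..N}) - {0}"
    have D: "finite D" "D \<subseteq> {0<..h}"
    proof -
      show "finite D" using graft.prems by (simp add: D_def)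
      have "dist p s \<le> h" if "s \<in> segment_in X p x" for s
      proof -
        have "dist p s + dist s x = dist p x" using that p graft(2) by (auto simp: segment_in_eq)
        then show ?thesis unfolding h_def using zero_le_dist[of s x] by linarith
      qed
      moreover have "real k * h / N \<le> h" if "k \<le> N" for k
        using that h N0 by (simp add: divide_simps)
      ultimately show "D \<subseteq> {0<..h}" using h by (auto simp: D_def)
    qed
    have inD: "real k * h / N \<in> insert 0 D" if "k \<le> N" for k
    proof (cases "k = 0")
      case False
      then have "k \<in> {1..N}" using that by simp
      then show ?thesis unfolding D_def by blast
    qed simp
    have hD: "h \<in> D" using inD[of N] N0 h by simp
    have mesh: "\<exists>s\<in>insert 0 D. s < t \<and> t \<le> s + \<delta>" if t: "t \<in> D" for t
    proof -
      \<comment> \<open>Ceiling minus one instead of the floor: the grid point must lie strictly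
        below \<open>t\<close>, also when \<open>t\<close> is itself a grid point.\<close>
      define k where "k = nat (\<lceil>t * N / h\<rceil> - 1)"
      have t0: "0 < t" "t \<le> h" using D(2) t by auto
      then have pos: "0 < t * N / h" using h N0 by simp
      then have "1 \<le> \<lceil>t * N / h\<rceil>" by linarith
      then have k: "real k < t * N / h" "t * N / h \<le> real k + 1" unfolding k_def by linarith+
      have "t * N / h \<le> N" using t0 h N0 by (simp add: divide_simps mult_right_mono)
      then have kN: "k < N" using k by linarith
      have "real k * h / N < t" using k(1) h N0 by (simp add: field_simps)
      moreover have "t \<le> real k * h / N + h / N" using k(2) h N0 by (simp add: field_simps)
      moreover have "real k * h / N \<in> insert 0 D" using inD kN by simp
      ultimately show ?thesis using step by fastforce
    qed
    have Max: "Max (insert 0 D) = h" using D hD h by (intro Max_eqI) auto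
    have tree: "finite_tree \<delta> (G \<union> f ` D) (L + h)"
      using finite_tree_on_edge[OF G(3,2) _ graft(1,2) p_def f(1,2,4), of D] G(1) p D mesh Max
      by (auto simp: h_def)
    have "f ` D \<subseteq> segment_in X p x" using D(2) f(1) by (force simp: h_def)
    moreover have "S \<inter> segment_in X p x \<subseteq> G \<union> f ` D"
    proof
      fix s assume s: "s \<in> S \<inter> segment_in X p x"
      then have "s \<in> f ` {0..dist p x}" using f(1) by simp
      then obtain t where t: "t \<in> {0..dist p x}" "s = f t" by blast
      then have ps: "dist p s = t" using f(4)[of 0 t] f(2) by auto
      show "s \<in> G \<union> f ` D"
      proof (cases "t = 0")
        case True
        then show ?thesis using t f(2) G(1) p by auto
      next
        case False
        then have "t \<in> D" using s ps unfolding D_def by blast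
        then show ?thesis using t by blast
      qed
    qed
    ultimately show ?thesis using tree G
      by (intro exI[of _ "G \<union> f ` D"]) (auto simp: p_def[symmetric] h_def)
  qed
qed

end

section \<open>Length\<close>

lemma ediam_le: "(\<And>x y. x \<in> C \<Longrightarrow> y \<in> C \<Longrightarrow> dist x y \<le> r) \<Longrightarrow> ediam C \<le> ennreal r"
  unfolding ediam_def by (intro SUP_least ennreal_leI) auto

lemma dist_le_ediam: "x \<in> C \<Longrightarrow> y \<in> C \<Longrightarrow> ennreal (dist x y) \<le> ediam C"
  unfolding ediam_def by (auto intro: SUP_upper2)

lemma ediam_empty [simp]: "ediam {} = 0"
  by (simp add: ediam_def bot_ennreal)

lemma hausdorff1_pre_le:
  "A \<subseteq> (\<Union>i. C i) \<Longrightarrow> (\<And>i. ediam (C i) \<le> ennreal \<delta>) \<Longrightarrow> hausdorff1_pre \<delta> A \<le> (\<Sum>i. ediam (C i))"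
  unfolding hausdorff1_pre_def by (rule INF_lower) auto

lemma le_hausdorff1_pre:
  "(\<And>C. A \<subseteq> (\<Union>i. C i) \<Longrightarrow> (\<And>i. ediam (C i) \<le> ennreal \<delta>) \<Longrightarrow> l \<le> (\<Sum>i. ediam (C i)))
    \<Longrightarrow> l \<le> hausdorff1_pre \<delta> A"
  unfolding hausdorff1_pre_def by (rule INF_greatest) auto

lemma hausdorff1_pre_mono: "A \<subseteq> B \<Longrightarrow> hausdorff1_pre \<delta> A \<le> hausdorff1_pre \<delta> B"
  by (intro le_hausdorff1_pre hausdorff1_pre_le) auto

lemma hausdorff1_pre_antimono:
  "\<delta> \<le> \<epsilon> \<Longrightarrow> hausdorff1_pre \<epsilon> A \<le> hausdorff1_pre \<delta> A"
  by (intro le_hausdorff1_pre hausdorff1_pre_le) (assumption, meson ennreal_leI order_trans)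

lemma hausdorff1_pre_separated:
  assumes sep: "\<And>x y. x \<in> A \<Longrightarrow> y \<in> B \<Longrightarrow> \<delta> < dist x y" and "0 < \<delta>"
  shows "hausdorff1_pre \<delta> A + hausdorff1_pre \<delta> B \<le> hausdorff1_pre \<delta> (A \<union> B)"
proof (rule le_hausdorff1_pre)
  fix C :: "nat \<Rightarrow> 'a set"
  assume cover: "A \<union> B \<subseteq> (\<Union>i. C i)" and small: "\<And>i. ediam (C i) \<le> ennreal \<delta>"
  define CA where "CA i = (if C i \<inter> A \<noteq> {} then C i else {})" for i
  define CB where "CB i = (if C i \<inter> B \<noteq> {} then C i else {})" for i
  have disj: "C i \<inter> A = {} \<or> C i \<inter> B = {}" for i
  proof (rule ccontr)
    assume "\<not> ?thesis"
    then obtain x y where xy: "x \<in> C i" "x \<in> A" "y \<in> C i" "y \<in> B" by blast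
    then have "ennreal (dist x y) \<le> ennreal \<delta>"
      using dist_le_ediam[of x "C i" y] small[of i] by auto
    then show False using sep[of x y] xy \<open>0 < \<delta>\<close> by (auto simp: ennreal_le_iff)
  qed
  have "hausdorff1_pre \<delta> A \<le> (\<Sum>i. ediam (CA i))"
    using cover small by (intro hausdorff1_pre_le) (auto simp: CA_def, blast)
  moreover have "hausdorff1_pre \<delta> B \<le> (\<Sum>i. ediam (CB i))"
    using cover small by (intro hausdorff1_pre_le) (auto simp: CB_def, blast)
  ultimately have "hausdorff1_pre \<delta> A + hausdorff1_pre \<delta> B \<le> (\<Sum>i. ediam (CA i) + ediam (CB i))"
    by (auto simp: suminf_add [symmetric] intro: add_mono)
  also have "\<dots> \<le> (\<Sum>i. ediam (C i))"
    using disj by (intro suminf_le) (auto simp: CA_def CB_def)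
  finally show "hausdorff1_pre \<delta> A + hausdorff1_pre \<delta> B \<le> (\<Sum>i. ediam (C i))" .
qed

text \<open>Pulled back along \<open>f\<close>, each covering set lies in an interval as long as its
  diameter; countable subadditivity of Lebesgue measure then bounds the sum from below.\<close>

lemma hausdorff1_pre_isometric_interval_ge:
  fixes f :: "real \<Rightarrow> 'a::metric_space"
  assumes iso: "\<And>s t. s \<in> {a..b} \<Longrightarrow> t \<in> {a..b} \<Longrightarrow> dist (f s) (f t) = \<bar>s - t\<bar>"
  shows "ennreal (b - a) \<le> hausdorff1_pre \<delta> (f ` {a..b})"
proof (cases "a \<le> b")
  case ab: True
  show ?thesis
  proof (rule le_hausdorff1_pre)
    fix C :: "nat \<Rightarrow> 'a set"
    assume cover: "f ` {a..b} \<subseteq> (\<Union>i. C i)" and small: "\<And>i. ediam (C i) \<le> ennreal \<delta>"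
    define r where "r i = enn2real (ediam (C i))" for i
    have r: "ediam (C i) = ennreal (r i)" "0 \<le> r i" for i
    proof -
      have "ediam (C i) < \<top>" using small[of i] by (rule order.strict_trans1) simp
      then show "ediam (C i) = ennreal (r i)" by (simp add: r_def)
    qed (simp add: r_def)
    define J where "J i = {t \<in> {a..b}. f t \<in> C i}" for i
    \<comment> \<open>An interval of length exactly r i containing J i; for empty J i any such interval will do.\<close>
    define K where "K i = {Sup (J i) - r i..Sup (J i)}" for i
    have bdd: "bdd_above (J i)" for i by (rule bdd_aboveI[of _ b]) (auto simp: J_def)
    have JK: "J i \<subseteq> K i" for i
    proof
      fix t assume t: "t \<in> J i"
      have "s \<le> t + r i" if s: "s \<in> J i" for s
      proof -
        have "ennreal \<bar>s - t\<bar> \<le> ennreal (r i)"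
          using s t dist_le_ediam[of "f s" "C i" "f t"] iso[of s t] r(1)[of i] by (auto simp: J_def)
        then show ?thesis using r(2)[of i] by (simp add: ennreal_le_iff)
      qed
      then have "Sup (J i) \<le> t + r i" using t by (intro cSup_least) auto
      moreover have "t \<le> Sup (J i)" using t bdd by (rule cSup_upper)
      ultimately show "t \<in> K i" by (simp add: K_def)
    qed
    have "{a..b} \<subseteq> (\<Union>i. J i)" using cover by (auto simp: J_def image_subset_iff)
    then have "{a..b} \<subseteq> (\<Union>i. K i)" using JK by blast
    then have "emeasure lborel {a..b} \<le> emeasure lborel (\<Union>i. K i)"
      by (intro emeasure_mono) (auto simp: K_def)
    also have "\<dots> \<le> (\<Sum>i. emeasure lborel (K i))"
      by (intro emeasure_subadditive_countably) (auto simp: K_def)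
    also have "\<dots> = (\<Sum>i. ediam (C i))" by (simp add: K_def r)
    finally show "ennreal (b - a) \<le> (\<Sum>i. ediam (C i))" using ab by simp
  qed
qed (simp add: ennreal_neg)

lemma isometric_interval_cover:
  fixes f :: "real \<Rightarrow> 'a::metric_space"
  assumes iso: "\<And>s t. s \<in> {0..h} \<Longrightarrow> t \<in> {0..h} \<Longrightarrow> dist (f s) (f t) = \<bar>s - t\<bar>"
    and "0 \<le> h" "0 < \<delta>"
  obtains C :: "nat \<Rightarrow> 'a set" where "f ` {0..h} \<subseteq> (\<Union>i. C i)" "\<And>i. ediam (C i) \<le> ennreal \<delta>"
    "(\<Sum>i. ediam (C i)) \<le> ennreal h"
proof -
  obtain N :: nat where N: "h / \<delta> < real N" using reals_Archimedean2 by blast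
  have "0 \<le> h / \<delta>" using assms(2,3) by simp
  then have N0: "0 < N" using N by (metis gr0I leD of_nat_0)
  have step: "h / N \<le> \<delta>" using N N0 assms(3) by (simp add: field_simps)
  \<comment> \<open>N pieces of length h / N, extended by empty sets to a sequence without changing
    the sum.\<close>
  define C where "C k = (if k < N then f ` ({real k * (h / N)..real k * (h / N) + h / N} \<inter> {0..h}) else {})" for k
  have diam: "ediam (C k) \<le> ennreal (h / N)" for k
  proof (rule ediam_le)
    fix x y assume "x \<in> C k" "y \<in> C k"
    moreover have "C k \<subseteq> f ` ({real k * (h / N)..real k * (h / N) + h / N} \<inter> {0..h})"
      by (simp add: C_def)
    ultimately obtain s t where "x = f s" "y = f t" "s \<in> {0..h}" "t \<in> {0..h}"
      "s \<in> {real k * (h / N)..real k * (h / N) + h / N}" "t \<in> {real k * (h / N)..real k * (h / N) + h / N}"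
      by blast
    then show "dist x y \<le> h / N" using iso[of s t] by auto
  qed
  show ?thesis
  proof (rule that[of C])
    show "ediam (C i) \<le> ennreal \<delta>" for i
      using diam[of i] step by (meson ennreal_leI order_trans)
    have "(\<Sum>i. ediam (C i)) = (\<Sum>i<N. ediam (C i))"
      by (rule suminf_finite) (auto simp: C_def)
    also have "\<dots> \<le> (\<Sum>i<N. ennreal (h / N))" by (intro sum_mono diam)
    also have "\<dots> = ennreal h" using N0 assms(2) by (simp add: ennreal_of_nat_eq_real_of_nat ennreal_mult [symmetric])
    finally show "(\<Sum>i. ediam (C i)) \<le> ennreal h" .
    show "f ` {0..h} \<subseteq> (\<Union>i. C i)"
    proof
      fix x assume "x \<in> f ` {0..h}"
      then obtain t where t: "0 \<le> t" "t \<le> h" "x = f t" by auto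
      have "\<exists>k<N. real k * (h / N) \<le> t \<and> t \<le> real k * (h / N) + h / N"
      proof (cases "t < h")
        case True
        define k where "k = nat \<lfloor>t * N / h\<rfloor>"
        have "0 \<le> t * N / h" using t by simp
        then have k: "real k \<le> t * N / h" "t * N / h < real k + 1" unfolding k_def by linarith+
        have "t * N / h < N" using True t(1) N0 by (simp add: divide_simps)
        then have "k < N" using k by linarith
        moreover have "real k * (h / N) \<le> t" "t \<le> real k * (h / N) + h / N"
          using k True t N0 by (auto simp: field_simps)
        ultimately show ?thesis by blast
      next
        \<comment> \<open>The floor would give index N, one too many. The right end t = h, and with
          it the case h = 0, goes to the last piece.\<close>
        case False
        then have "t = h" using t by simp
        have "real (N - 1) * (h / N) = h - h / N" using N0 by (simp add: field_simps of_nat_diff)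
        then show ?thesis using N0 assms(2) \<open>t = h\<close> by (intro exI[of _ "N - 1"]) auto
      qed
      then show "x \<in> (\<Union>i. C i)" using t unfolding C_def by fastforce
    qed
  qed
qed

text \<open>The efficient covers of the single intervals are merged into one sequence by the pairing
  of naturals.\<close>

lemma hausdorff1_pre_UN_isometric_intervals_le:
  fixes f :: "nat \<Rightarrow> real \<Rightarrow> 'a::metric_space"
  assumes iso: "\<And>n s t. s \<in> {0..h n} \<Longrightarrow> t \<in> {0..h n} \<Longrightarrow> dist (f n s) (f n t) = \<bar>s - t\<bar>"
    and h: "\<And>n. 0 \<le> h n" and \<delta>: "0 < \<delta>" and A: "A \<subseteq> (\<Union>n. f n ` {0..h n})"
  shows "hausdorff1_pre \<delta> A \<le> (\<Sum>n. ennreal (h n))"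
proof -
  define P where "P n C \<longleftrightarrow> f n ` {0..h n} \<subseteq> (\<Union>i. C i) \<and> (\<forall>i. ediam (C i) \<le> ennreal \<delta>) \<and>
      (\<Sum>i. ediam (C i)) \<le> ennreal (h n)" for n and C :: "nat \<Rightarrow> 'a set"
  have "\<forall>n. \<exists>C. P n C"
  proof
    fix n
    show "\<exists>C. P n C"
      unfolding P_def by (rule isometric_interval_cover[OF iso[where n = n] h[of n] \<delta>]) blast+
  qed
  then obtain C where "\<forall>n. P n (C n)" by (rule choice[THEN exE])
  then have C: "f n ` {0..h n} \<subseteq> (\<Union>i. C n i)" "ediam (C n i) \<le> ennreal \<delta>"
    "(\<Sum>i. ediam (C n i)) \<le> ennreal (h n)" for n i
    unfolding P_def by blast+
  define B where "B k = (case prod_decode k of (n, i) \<Rightarrow> C n i)" for k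
  have "x \<in> (\<Union>k. B k)" if x: "x \<in> A" for x
  proof -
    obtain n where "x \<in> f n ` {0..h n}" using x A by blast
    then obtain i where "x \<in> C n i" using C(1)[of n] by blast
    then have "x \<in> B (prod_encode (n, i))" by (simp add: B_def)
    then show ?thesis by blast
  qed
  then have "hausdorff1_pre \<delta> A \<le> (\<Sum>k. ediam (B k))"
    using C(2) by (intro hausdorff1_pre_le) (auto simp: B_def split: prod.split)
  also have "\<dots> = (\<Sum>n. \<Sum>i. ediam (C n i))"
    unfolding B_def
    using suminf_ennreal_2dimen[where f = "\<lambda>z. ediam (case z of (n, i) \<Rightarrow> C n i)", OF refl] by simp
  also have "\<dots> \<le> (\<Sum>n. ennreal (h n))"
    by (intro suminf_le C) auto
  finally show ?thesis .
qed

lemma compact_finite_net: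
  fixes X :: "'a::metric_space set"
  assumes "compact X" "0 < e"
  shows "\<exists>K. finite K \<and> K \<subseteq> X \<and> X \<subseteq> (\<Union>x\<in>K. ball x e)"
  using seq_compact_imp_totally_bounded[of X] assms by (auto simp: compact_eq_seq_compact_metric)

lemma compact_dense_sequence:
  fixes X :: "'a::metric_space set"
  assumes "compact X" "X \<noteq> {}"
  shows "\<exists>s :: nat \<Rightarrow> 'a. range s \<subseteq> X \<and> (\<forall>x\<in>X. \<forall>e>0. \<exists>n. dist x (s n) < e)"
proof -
  have "\<exists>K. finite K \<and> K \<subseteq> X \<and> X \<subseteq> (\<Union>x\<in>K. ball x (inverse (real (Suc n))))" for n :: nat
    using assms(1) by (rule compact_finite_net) simp
  then obtain K where K: "\<And>n :: nat. finite (K n)" "\<And>n. K n \<subseteq> X"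
    "\<And>n. X \<subseteq> (\<Union>x\<in>K n. ball x (inverse (real (Suc n))))"
    by metis
  define D where "D = (\<Union>n. K n)"
  have D: "countable D" "D \<subseteq> X" "D \<noteq> {}"
  proof -
    show "countable D" unfolding D_def using K(1) by (intro countable_UN countable_finite[OF K(1)]) auto
    show "D \<subseteq> X" using K(2) by (auto simp: D_def)
    show "D \<noteq> {}" using K(3)[of 0] assms(2) by (auto simp: D_def)
  qed
  show ?thesis
  proof (intro exI[of _ "from_nat_into D"] conjI ballI allI impI)
    show "range (from_nat_into D) \<subseteq> X" using D by (simp add: range_from_nat_into)
    fix x and e :: real assume x: "x \<in> X" and e: "0 < e"
    obtain n :: nat where n: "inverse (real (Suc n)) < e" using reals_Archimedean[OF e] by auto
    obtain y where y: "y \<in> K n" "dist y x < inverse (real (Suc n))" using K(3)[of n] x by auto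
    then have "y \<in> D" by (auto simp: D_def)
    then obtain m where "from_nat_into D m = y" using D by (metis from_nat_into_surj)
    then show "\<exists>m. dist x (from_nat_into D m) < e" using y n by (intro exI[of _ m]) (simp add: dist_commute)
  qed
qed

section \<open>Total length as the supremum of the lengths of subtrees\<close>

context R_tree
begin

text \<open>A premeasure is superadditive only across gaps wider than its scale, so the induction
  carries a scale along with the set. Of the loss \<eta>, one half is spent on the earlier edges and
  a quarter on each end of the new one.\<close>

lemma subtree_length_approx:
  assumes "subtree T L" "0 < \<eta>"
  shows "\<exists>K \<delta>. K \<subseteq> T \<and> K \<subseteq> skeleton X \<and> 0 < \<delta> \<and> ennreal (L - \<eta>) \<le> hausdorff1_pre \<delta> K"
  using assms
proof (induction arbitrary: \<eta> rule: subtree.induct)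
  case (point x)
  then show ?case by (intro exI[of _ "{}"] exI[of _ 1]) (auto simp: ennreal_neg)
next
  case (graft T L x)
  define p where "p = gate T x"
  define h where "h = dist p x"
  have p: "p \<in> T" "p \<in> X" using subtree_gate[OF graft(1)] by (auto simp: p_def)
  obtain f where f: "f ` {0..dist p x} = segment_in X p x" "f 0 = p" "f (dist p x) = x"
    "\<And>s t. s \<in> {0..dist p x} \<Longrightarrow> t \<in> {0..dist p x} \<Longrightarrow> dist (f s) (f t) = \<bar>s - t\<bar>"
    using segment_parametrization p graft(2) by metis
  obtain K \<delta> where K: "K \<subseteq> T" "K \<subseteq> skeleton X" "0 < \<delta>" "ennreal (L - \<eta> / 2) \<le> hausdorff1_pre \<delta> K"
    using graft.IH[of "\<eta> / 2"] graft.prems by auto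
  \<comment> \<open>The scale must not exceed \<delta>, to keep the bound for \<open>K\<close>, and
    must be below \<eta> / 4: a path from \<open>I\<close> into \<open>T\<close> first covers at
    least that distance to reach \<open>p\<close>.\<close>
  define \<epsilon> where "\<epsilon> = min \<delta> (\<eta> / 8)"
  have \<epsilon>: "0 < \<epsilon>" "\<epsilon> \<le> \<delta>" "\<epsilon> < \<eta> / 4" using K(3) graft.prems by (auto simp: \<epsilon>_def)
  define I where "I = f ` {\<eta> / 4..h - \<eta> / 4}"
  have sub: "{\<eta> / 4..h - \<eta> / 4} \<subseteq> {0<..<h}" using graft.prems by auto
  have I: "I \<subseteq> segment_in X p x - {p, x}"
  proof
    fix z assume "z \<in> I"
    then have "z \<in> f ` {0<..<dist p x}" using sub unfolding I_def h_def by blast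
    then obtain t where t: "0 < t" "t < dist p x" "z = f t" by auto
    then have "z \<in> segment_in X p x" using f(1) by auto
    moreover have "dist p z = t" "dist z x = dist p x - t"
      using f(4)[of 0 t] f(4)[of t "dist p x"] f(2,3) t by auto
    ultimately show "z \<in> segment_in X p x - {p, x}" using t by auto
  qed
  have sep: "\<epsilon> < dist y z" if yz: "y \<in> K" "z \<in> I" for y z
  proof -
    obtain t where t: "\<eta> / 4 \<le> t" "t \<le> h - \<eta> / 4" "z = f t" using yz(2) by (auto simp: I_def)
    then have "dist p z = t" using f(4)[of 0 t] f(2) graft.prems by (auto simp: h_def)
    moreover have "dist z y = dist p z + dist p y"
      using subtree_dist_through_gate[OF graft(1,2), of y z] yz I K(1) by (auto simp: p_def)
    ultimately show ?thesis
      using t \<epsilon> zero_le_dist[of p y] unfolding dist_commute[of y] by linarith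
  qed
  \<comment> \<open>\<open>ennreal\<close> truncates negative numbers to 0, so an edge shorter than
    \<eta> / 2 contributes 0; each sign case still gives the inequality.\<close>
  have "ennreal (L + h - \<eta>) \<le> ennreal (L - \<eta> / 2) + ennreal (h - \<eta> / 2)"
  proof (cases "0 \<le> L - \<eta> / 2 \<and> 0 \<le> h - \<eta> / 2")
    case True
    then show ?thesis by (simp add: ennreal_plus [symmetric] del: ennreal_plus)
  next
    case False
    then consider "L - \<eta> / 2 < 0" | "h - \<eta> / 2 < 0" by linarith
    then show ?thesis
      by cases (auto intro!: ennreal_leI simp: ennreal_neg)
  qed
  also have "\<dots> \<le> hausdorff1_pre \<epsilon> K + hausdorff1_pre \<epsilon> I"
  proof (rule add_mono)
    show "ennreal (L - \<eta> / 2) \<le> hausdorff1_pre \<epsilon> K"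
      using K(4) hausdorff1_pre_antimono[OF \<epsilon>(2)] by (rule order_trans)
    show "ennreal (h - \<eta> / 2) \<le> hausdorff1_pre \<epsilon> I"
    proof -
      have "ennreal ((h - \<eta> / 4) - \<eta> / 4) \<le> hausdorff1_pre \<epsilon> I"
        unfolding I_def using sub
        by (intro hausdorff1_pre_isometric_interval_ge f(4)) (fastforce simp: h_def)+
      then show ?thesis by simp
    qed
  qed
  also have "\<dots> \<le> hausdorff1_pre \<epsilon> (K \<union> I)"
    using sep \<epsilon>(1) by (rule hausdorff1_pre_separated)
  finally have "ennreal (L + h - \<eta>) \<le> hausdorff1_pre \<epsilon> (K \<union> I)" .
  moreover have "I \<subseteq> skeleton X" unfolding skeleton_def using I p graft(2) by blast
  ultimately show ?case
    using K \<epsilon>(1) I unfolding p_def[symmetric] h_def[symmetric]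
    by (intro exI[of _ "K \<union> I"] exI[of _ \<epsilon>]) blast
qed

lemma subtree_length_nonneg: "subtree T L \<Longrightarrow> 0 \<le> L"
  by (induction rule: subtree.induct) auto

lemma subtree_length_le:
  assumes "subtree T L"
  shows "ennreal L \<le> total_length X"
proof (rule ennreal_le_epsilon)
  fix e :: real assume e: "0 < e"
  obtain K \<delta> where K: "K \<subseteq> skeleton X" "0 < \<delta>" "ennreal (L - e) \<le> hausdorff1_pre \<delta> K"
    using subtree_length_approx[OF assms e] by blast
  have "ennreal L \<le> ennreal (L - e) + ennreal e"
    using e by (cases "0 \<le> L - e") (auto simp: ennreal_plus [symmetric] ennreal_neg intro: ennreal_leI simp del: ennreal_plus)
  moreover have "ennreal (L - e) \<le> total_length X"
  proof -
    have "hausdorff1_pre \<delta> (skeleton X) \<le> total_length X"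
      unfolding total_length_def hausdorff1_def using K(2) by (intro SUP_upper) auto
    then show ?thesis using K(3) hausdorff1_pre_mono[OF K(1), of \<delta>] by order
  qed
  ultimately show "ennreal L \<le> total_length X + ennreal e"
    by (meson add_right_mono order_trans)
qed

text \<open>Step n grafts \<open>s n\<close>, which therefore lies in stage \<open>Suc n\<close>.
  The first graft repeats \<open>s 0\<close> and adds nothing.\<close>

primrec exhaust :: "(nat \<Rightarrow> 'a) \<Rightarrow> nat \<Rightarrow> 'a set" where
  "exhaust s 0 = {s 0}"
| "exhaust s (Suc n) = exhaust s n \<union> segment_in X (gate (exhaust s n) (s n)) (s n)"

lemma subtree_exhaust:
  "range s \<subseteq> X \<Longrightarrow> subtree (exhaust s n) (\<Sum>i<n. dist (gate (exhaust s i) (s i)) (s i))"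
proof (induction n)
  case 0
  then show ?case by (auto intro: point)
next
  case (Suc n)
  then show ?case using graft[of "exhaust s n" _ "s n"] by auto
qed

text \<open>Let z be strictly between x and y. A point s n closer to x than z is cannot have z
  between x and itself, so z is between s n and y; the same move replaces y. Only interior points
  are reached this way, hence the skeleton.\<close>

lemma skeleton_subset_exhaust:
  assumes s: "range s \<subseteq> X" and dense: "\<forall>x\<in>X. \<forall>e>0. \<exists>n. dist x (s n) < e"
  shows "skeleton X \<subseteq> (\<Union>n. exhaust s n)"
proof
  have mono: "exhaust s m \<subseteq> exhaust s n" if "m \<le> n" for m n
    using that by (induction n rule: dec_induct) auto
  have mem: "s n \<in> exhaust s (Suc n)" for n
    using ends_in_segment(2)[of "gate (exhaust s n) (s n)" "s n"] s
      subtree_gate(2)[OF subtree_exhaust[OF s, of n]] by auto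
  fix z assume "z \<in> skeleton X"
  then obtain x y where xy: "x \<in> X" "y \<in> X" "z \<in> segment_in X x y" "z \<noteq> x" "z \<noteq> y"
    by (auto simp: skeleton_def)
  then have z: "z \<in> X" "dist x z + dist z y = dist x y" by (auto simp: segment_in_eq)
  obtain n where n: "dist x (s n) < dist x z" using dense xy by (metis zero_less_dist_iff)
  obtain m where m: "dist y (s m) < dist y z" using dense xy by (metis zero_less_dist_iff)
  have sX: "s n \<in> X" "s m \<in> X" using s by auto
  have "dist (s n) z + dist z y = dist (s n) y"
    using between_cases[OF xy(1) sX(1) xy(2) z] n zero_le_dist[of z "s n"] by linarith
  then have "dist (s n) z + dist z (s m) = dist (s n) (s m)"
    using between_cases[OF sX(1) sX(2) xy(2) z(1)] m zero_le_dist[of "s m" z]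
    unfolding dist_commute[of y] by linarith
  then have "z \<in> segment_in X (s n) (s m)" using sX z by (simp add: segment_in_eq)
  moreover have "s n \<in> exhaust s (Suc (max n m))" "s m \<in> exhaust s (Suc (max n m))"
    using mem[of n] mem[of m] mono[of "Suc n" "Suc (max n m)"] mono[of "Suc m" "Suc (max n m)"]
    by (meson Suc_le_mono max.cobounded1 max.cobounded2 subsetD)+
  ultimately have "z \<in> exhaust s (Suc (max n m))"
    using subtree_basic[OF subtree_exhaust[OF s, of "Suc (max n m)"], THEN conjunct2, THEN conjunct2, THEN conjunct2]
    by (metis subsetD)
  then show "z \<in> (\<Union>n. exhaust s n)" by blast
qed

text \<open>The skeleton is covered by the segments grafted along a dense sequence. Their partial
  length sums are lengths of subtrees, so the full sum is at most \<open>M\<close>, and it bounds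
  the premeasure at every scale.\<close>

lemma total_length_le:
  assumes bound: "\<And>T L. subtree T L \<Longrightarrow> ennreal L \<le> M"
  shows "total_length X \<le> M"
proof -
  obtain s :: "nat \<Rightarrow> 'a" where s: "range s \<subseteq> X" "\<forall>x\<in>X. \<forall>e>0. \<exists>n. dist x (s n) < e"
    using compact_dense_sequence[OF compact nonempty] by blast
  define p where "p n = gate (exhaust s n) (s n)" for n
  have p: "p n \<in> X" for n using subtree_gate[OF subtree_exhaust[OF s(1)]] by (simp add: p_def)
  have sX: "s n \<in> X" for n using s(1) by auto
  have "\<exists>f. f ` {0..dist (p n) (s n)} = segment_in X (p n) (s n) \<and>
      (\<forall>s'\<in>{0..dist (p n) (s n)}. \<forall>t\<in>{0..dist (p n) (s n)}. dist (f s') (f t) = \<bar>s' - t\<bar>)" for n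
    using segment_parametrization[OF p[of n] sX[of n]] by metis
  then obtain f where f: "\<And>n. f n ` {0..dist (p n) (s n)} = segment_in X (p n) (s n)"
    "\<And>n s' t. s' \<in> {0..dist (p n) (s n)} \<Longrightarrow> t \<in> {0..dist (p n) (s n)} \<Longrightarrow> dist (f n s') (f n t) = \<bar>s' - t\<bar>"
    by metis
  have "exhaust s n \<subseteq> (\<Union>n. segment_in X (p n) (s n))" for n
  proof (induction n)
    case 0
    then show ?case using ends_in_segment(2)[OF p sX, of 0 0] by auto
  next
    case (Suc n)
    then show ?case by (auto simp: p_def)
  qed
  then have cover: "skeleton X \<subseteq> (\<Union>n. f n ` {0..dist (p n) (s n)})"
    unfolding f(1) by (intro order_trans[OF skeleton_subset_exhaust[OF s]] UN_least)
  have "(\<Sum>n. ennreal (dist (p n) (s n))) \<le> M"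
  proof -
    have "(\<Sum>i<n. ennreal (dist (p i) (s i))) \<le> M" for n
      using bound[OF subtree_exhaust[OF s(1), of n]] by (simp add: p_def)
    then show ?thesis by (simp add: suminf_eq_SUP SUP_le_iff)
  qed
  moreover have "hausdorff1_pre \<delta> (skeleton X) \<le> (\<Sum>n. ennreal (dist (p n) (s n)))" if "0 < \<delta>" for \<delta>
    using that cover by (intro hausdorff1_pre_UN_isometric_intervals_le[where f = f] f(2)) simp_all
  ultimately have "hausdorff1_pre \<delta> (skeleton X) \<le> M" if "0 < \<delta>" for \<delta>
    using that order_trans by blast
  then show ?thesis by (auto simp: total_length_def hausdorff1_def intro: SUP_least)
qed

end

section \<open>Measures\<close>

lemma abs_exp_minus_diff_le:
  fixes a b :: real
  assumes "0 \<le> a" "0 \<le> b"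
  shows "\<bar>exp (- a) - exp (- b)\<bar> \<le> \<bar>a - b\<bar>"
proof -
  have *: "exp (- a) - exp (- b) \<le> b - a \<and> exp (- b) \<le> exp (- a)" if "0 \<le> a" "a \<le> b" for a b :: real
  proof -
    have "1 - (b - a) \<le> exp (- (b - a))" using exp_ge_add_one_self[of "- (b - a)"] by linarith
    then have "exp (- a) * (1 - exp (- (b - a))) \<le> exp (- a) * (b - a)"
      by (intro mult_left_mono) auto
    also have "\<dots> \<le> 1 * (b - a)" using that by (intro mult_right_mono) auto
    finally show ?thesis using that by (simp add: algebra_simps exp_add [symmetric])
  qed
  show ?thesis using *[of a b] *[of b a] assms by (cases "a \<le> b") auto
qed

lemma abs_exp_minus_dist_diff_le:
  "\<bar>exp (- dist x y) - exp (- dist x' y')\<bar> \<le> dist x x' + dist y y'"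
proof -
  have "\<bar>dist x y - dist x' y'\<bar> \<le> dist x x' + dist y y'"
    using dist_triangle[of x y x'] dist_triangle[of x' y y'] dist_triangle[of x' y' x] dist_triangle[of x y' y]
    by (simp add: dist_commute abs_le_iff)
  then show ?thesis using abs_exp_minus_diff_le[of "dist x y" "dist x' y'"] by simp
qed

lemma (in finite_measure) abs_integral_diff_le:
  fixes f g :: "'a \<Rightarrow> real"
  assumes "integrable M f" "integrable M g" "\<And>x. x \<in> space M \<Longrightarrow> \<bar>f x - g x\<bar> \<le> c"
  shows "\<bar>integral\<^sup>L M f - integral\<^sup>L M g\<bar> \<le> c * measure M (space M)"
proof -
  have bounds: "f x - g x \<le> c" "- c \<le> f x - g x" if "x \<in> space M" for x
    using assms(3)[OF that] by linarith+
  have "(\<integral>x. f x - g x \<partial>M) \<le> (\<integral>x. c \<partial>M)"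
    by (rule integral_mono) (use assms(1,2) bounds in auto)
  moreover have "(\<integral>x. - c \<partial>M) \<le> (\<integral>x. f x - g x \<partial>M)"
    by (rule integral_mono) (use assms(1,2) bounds in auto)
  ultimately show ?thesis using assms(1,2) by (simp add: abs_le_iff mult.commute)
qed

lemma finite_borel_onD:
  assumes "finite_borel_on X M"
  shows "finite_measure M" "space M = X" "f \<in> borel_measurable borel \<Longrightarrow> f \<in> borel_measurable M"
    "r \<in> borel \<rightarrow>\<^sub>M count_space UNIV \<Longrightarrow> r \<in> M \<rightarrow>\<^sub>M count_space UNIV"
proof -
  have s: "sets M = sets (restrict_space borel X)" and "finite_measure M"
    using assms by (auto simp: finite_borel_on_def)
  then show "finite_measure M" by simp
  show "space M = X" using sets_eq_imp_space_eq[OF s] by (simp add: space_restrict_space)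
  show "f \<in> borel_measurable borel \<Longrightarrow> f \<in> borel_measurable M"
    "r \<in> borel \<rightarrow>\<^sub>M count_space UNIV \<Longrightarrow> r \<in> M \<rightarrow>\<^sub>M count_space UNIV"
    by (auto simp: measurable_cong_sets[OF s refl] intro: measurable_restrict_space1)
qed

lemma integral_comp_finite_range:
  fixes M :: "'a measure" and g :: "'b \<Rightarrow> real"
  assumes "finite_measure M" "finite F" "r \<in> M \<rightarrow>\<^sub>M count_space UNIV" "\<And>x. r x \<in> F"
  shows "(\<integral>x. g (r x) \<partial>M) = (\<Sum>u\<in>F. measure M {x \<in> space M. r x = u} * g u)"
proof -
  interpret finite_measure M by fact
  have meas: "{x \<in> space M. r x = u} \<in> sets M" for u
    using measurable_sets[OF assms(3), of "{u}"] by (simp add: vimage_def Int_def conj_commute)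
  have "(\<integral>x. g (r x) \<partial>M) = (\<integral>x. (\<Sum>u\<in>F. indicator {x \<in> space M. r x = u} x * g u) \<partial>M)"
  proof (rule Bochner_Integration.integral_cong)
    fix x assume "x \<in> space M"
    then have "(\<Sum>u\<in>F. indicator {x \<in> space M. r x = u} x * g u) = (\<Sum>u\<in>F. if u = r x then g u else 0)"
      by (intro sum.cong) (auto simp: indicator_def)
    then show "g (r x) = (\<Sum>u\<in>F. indicator {x \<in> space M. r x = u} x * g u)"
      using assms(2,4) by simp
  qed simp
  also have "\<dots> = (\<Sum>u\<in>F. \<integral>x. indicator {x \<in> space M. r x = u} x * g u \<partial>M)"
    using meas by (intro Bochner_Integration.integral_sum integrable_mult_left) (simp add: emeasure_eq_measure)
  also have "\<dots> = (\<Sum>u\<in>F. measure M {x \<in> space M. r x = u} * g u)"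
    using meas by (intro sum.cong) (simp_all add: sets.Int_space_eq2)
  finally show ?thesis .
qed

text \<open>Balls are split off one at a time, so the fibres are Borel. The discrete target makes
  every function of \<open>r x\<close> measurable.\<close>

lemma finite_net_projection:
  fixes F :: "'a::metric_space set"
  assumes "finite F" "F \<noteq> {}"
  shows "\<exists>r. r \<in> borel \<rightarrow>\<^sub>M count_space UNIV \<and> (\<forall>x. r x \<in> F) \<and>
    (\<forall>x. (\<exists>u\<in>F. dist u x < \<epsilon>) \<longrightarrow> dist x (r x) < \<epsilon>)"
  using assms
proof (induction rule: finite_ne_induct)
  case (singleton u)
  show ?case by (rule exI[of _ "\<lambda>_. u"]) (auto simp: dist_commute)
next
  case (insert u F)
  then obtain r where r: "r \<in> borel \<rightarrow>\<^sub>M count_space UNIV" "\<And>x. r x \<in> F"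
    "\<And>x v. v \<in> F \<Longrightarrow> dist v x < \<epsilon> \<Longrightarrow> dist x (r x) < \<epsilon>" by blast
  have "(\<lambda>x. if x \<in> ball u \<epsilon> then u else r x) \<in> borel \<rightarrow>\<^sub>M count_space UNIV"
    using r(1) by (intro measurable_If_set) auto
  then show ?case using r(2,3)
    by (intro exI[of _ "\<lambda>x. if x \<in> ball u \<epsilon> then u else r x"]) (auto simp: dist_commute)
qed

text \<open>The kernel is 1-Lipschitz in each variable, so replacing x and y by r x and r y changes
  it by at most 2 \<epsilon>; the new double integral is a sum over fibre masses.\<close>

lemma wprod_discretization:
  fixes P N :: "'a::metric_space measure"
  assumes P: "finite_borel_on X P" and N: "finite_borel_on X N"
    and F: "finite F" and r: "r \<in> borel \<rightarrow>\<^sub>M count_space UNIV" "\<And>x. r x \<in> F"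
    and close: "\<And>x. x \<in> X \<Longrightarrow> dist x (r x) < \<epsilon>"
  shows "\<bar>wprod P N - (\<Sum>u\<in>F. \<Sum>v\<in>F. measure P {x \<in> X. r x = u} * measure N {x \<in> X. r x = v} * exp (- dist u v))\<bar>
    \<le> 2 * \<epsilon> * measure N X * measure P X"
proof -
  note MP = finite_borel_onD[OF P] and MN = finite_borel_onD[OF N]
  interpret P: finite_measure P by (rule MP)
  interpret N: finite_measure N by (rule MN)
  define g where "g u = (\<Sum>v\<in>F. measure N {x \<in> X. r x = v} * exp (- dist u v))" for u
  have cont: "(\<lambda>y. exp (- dist x y)) \<in> borel_measurable borel" for x :: 'a
    by (intro borel_measurable_continuous_onI continuous_intros)
  have comp: "(\<lambda>y. h (r y)) \<in> borel_measurable borel" for h :: "'a \<Rightarrow> real"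
    using measurable_compose[OF r(1), of h borel] by simp
  have intN: "integrable N (\<lambda>y. exp (- dist x y))" "integrable N (\<lambda>y. exp (- dist (r x) (r y)))" for x
    using MN(3)[OF cont[of x]] MN(3)[OF comp[of "\<lambda>z. exp (- dist (r x) z)"]]
    by (auto intro!: N.integrable_const_bound[of _ 1])
  have g: "(\<integral>y. exp (- dist (r x) (r y)) \<partial>N) = g (r x)" for x
    using integral_comp_finite_range[OF MN(1) F MN(4)[OF r(1)] r(2), of "\<lambda>z. exp (- dist (r x) z)"]
    by (simp add: g_def MN(2))
  have inner: "\<bar>(\<integral>y. exp (- dist x y) \<partial>N) - g (r x)\<bar> \<le> 2 * \<epsilon> * measure N X" if x: "x \<in> X" for x
    unfolding g[symmetric] MN(2)[symmetric]
  proof (rule N.abs_integral_diff_le[OF intN])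
    fix y assume "y \<in> space N"
    then show "\<bar>exp (- dist x y) - exp (- dist (r x) (r y))\<bar> \<le> 2 * \<epsilon>"
      using abs_exp_minus_dist_diff_le[of x y "r x" "r y"] close[of x] close[of y] x MN(2) by auto
  qed
  have lip: "\<bar>(\<integral>y. exp (- dist x y) \<partial>N) - (\<integral>y. exp (- dist x' y) \<partial>N)\<bar> \<le> dist x x' * measure N (space N)" for x x'
    using abs_exp_minus_dist_diff_le[of x _ x'] by (intro N.abs_integral_diff_le intN) (metis add.right_neutral dist_self)
  \<comment> \<open>Joint measurability is not available, since the ambient space need not be second countable:
    the inner integral is measurable because it is Lipschitz.\<close>
  have "(measure N (space N))-lipschitz_on UNIV (\<lambda>x. \<integral>y. exp (- dist x y) \<partial>N)"
    using lip by (intro lipschitz_onI) (auto simp: dist_real_def mult.commute)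
  then have "continuous_on UNIV (\<lambda>x. \<integral>y. exp (- dist x y) \<partial>N)"
    by (rule lipschitz_on_continuous_on)
  then have meas: "(\<lambda>x. \<integral>y. exp (- dist x y) \<partial>N) \<in> borel_measurable borel"
    by (rule borel_measurable_continuous_onI)
  have "norm (\<integral>y. exp (- dist x y) \<partial>N) \<le> measure N (space N)" for x
    using N.abs_integral_diff_le[OF intN(1)[of x], of "\<lambda>_. 0" 1] by simp
  then have intP: "integrable P (\<lambda>x. \<integral>y. exp (- dist x y) \<partial>N)"
    using MP(3)[OF meas] by (intro P.integrable_const_bound[of _ "measure N (space N)"]) auto
  have "\<bar>g (r x)\<bar> \<le> (\<Sum>u\<in>F. \<bar>g u\<bar>)" for x
    using F r(2) by (intro member_le_sum) auto
  then have intP': "integrable P (\<lambda>x. g (r x))"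
    using MP(3)[OF comp[of g]] by (intro P.integrable_const_bound[of _ "\<Sum>u\<in>F. \<bar>g u\<bar>"]) auto
  have "\<bar>wprod P N - (\<integral>x. g (r x) \<partial>P)\<bar> \<le> 2 * \<epsilon> * measure N X * measure P X"
    using P.abs_integral_diff_le[OF intP intP', of "2 * \<epsilon> * measure N X"] inner
    by (simp add: wprod_def MP(2))
  moreover have "(\<integral>x. g (r x) \<partial>P) = (\<Sum>u\<in>F. measure P {x \<in> X. r x = u} * g u)"
    using integral_comp_finite_range[OF MP(1) F MP(4)[OF r(1)] r(2), of g] by (simp add: MP(2))
  ultimately show ?thesis by (simp add: g_def sum_distrib_left mult_ac)
qed

lemma exp_energy_diff:
  "exp_energy F (\<lambda>u. p u - n u) =
    (\<Sum>u\<in>F. \<Sum>v\<in>F. p u * p v * exp (- dist u v)) - (\<Sum>u\<in>F. \<Sum>v\<in>F. p u * n v * exp (- dist u v))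
    - (\<Sum>u\<in>F. \<Sum>v\<in>F. n u * p v * exp (- dist u v)) + (\<Sum>u\<in>F. \<Sum>v\<in>F. n u * n v * exp (- dist u v))"
  unfolding exp_energy_def by (simp add: sum_subtractf [symmetric] sum.distrib [symmetric] algebra_simps)

text \<open>Total mass is preserved exactly and only the energy moves; the errors of the four
  products add up to the square of the sum of the masses.\<close>

lemma wnorm2_discretization:
  fixes P N :: "'a::metric_space measure"
  assumes P: "finite_borel_on X P" and N: "finite_borel_on X N"
    and F: "finite F" "F \<noteq> {}" and net: "\<And>x. x \<in> X \<Longrightarrow> \<exists>u\<in>F. dist u x < \<epsilon>"
  shows "\<exists>a. sum a F = measure P X - measure N X \<and>
    \<bar>wnorm2 P N - exp_energy F a\<bar> \<le> 2 * \<epsilon> * (measure P X + measure N X)\<^sup>2"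
proof -
  obtain r where r: "r \<in> borel \<rightarrow>\<^sub>M count_space UNIV" "\<And>x. r x \<in> F"
    and close: "\<And>x. x \<in> X \<Longrightarrow> dist x (r x) < \<epsilon>"
    using finite_net_projection[OF F, of \<epsilon>] net by blast
  define p where "p u = measure P {x \<in> X. r x = u}" for u
  define n where "n u = measure N {x \<in> X. r x = u}" for u
  have total: "(\<Sum>u\<in>F. measure M {x \<in> X. r x = u}) = measure M X" if "finite_borel_on X M" for M
    using integral_comp_finite_range[OF finite_borel_onD(1)[OF that] F(1) finite_borel_onD(4)[OF that r(1)] r(2), of "\<lambda>_. 1"]
    by (simp add: finite_borel_onD(2)[OF that])
  note approx = wprod_discretization[OF _ _ F(1) r close]
  have "\<bar>wnorm2 P N - exp_energy F (\<lambda>u. p u - n u)\<bar> \<le> 2 * \<epsilon> * (measure P X + measure N X)\<^sup>2"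
    using approx[OF P P] approx[OF P N] approx[OF N P] approx[OF N N]
    unfolding exp_energy_diff wnorm2_def p_def[symmetric] n_def[symmetric] abs_le_iff
    by (simp add: power2_eq_square algebra_simps)
  moreover have "(\<Sum>u\<in>F. p u - n u) = measure P X - measure N X"
    unfolding sum_subtractf p_def n_def total[OF P] total[OF N] ..
  ultimately show ?thesis by blast
qed

text \<open>The push-forward under the identity replaces the power set of \<open>F\<close> by the
  Borel sets of \<open>X\<close>, as \<open>finite_borel_on\<close> demands.\<close>

definition atomic_measure :: "'a::metric_space set \<Rightarrow> 'a set \<Rightarrow> ('a \<Rightarrow> real) \<Rightarrow> 'a measure" where
  "atomic_measure X F w = distr (point_measure F (\<lambda>x. ennreal (w x))) (restrict_space borel X) id"

lemma finite_borel_on_atomic_measure: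
  assumes "finite F" "F \<subseteq> X"
  shows "finite_borel_on X (atomic_measure X F w)"
proof -
  have "finite_measure (point_measure F (\<lambda>x. ennreal (w x)))"
    using assms(1) by (intro finite_measureI)
      (simp add: space_point_measure emeasure_point_measure_finite)
  moreover have "id \<in> point_measure F (\<lambda>x. ennreal (w x)) \<rightarrow>\<^sub>M restrict_space borel X"
    using assms(2) by (auto simp: measurable_point_measure_eq1 space_restrict_space)
  ultimately show ?thesis
    by (simp add: finite_borel_on_def atomic_measure_def finite_measure.finite_measure_distr)
qed

lemma integral_atomic_measure:
  assumes "finite F" "F \<subseteq> X" "\<And>x. x \<in> F \<Longrightarrow> 0 \<le> w x" "g \<in> borel_measurable borel"
  shows "(\<integral>x. g x \<partial>atomic_measure X F w) = (\<Sum>x\<in>F. w x * (g x :: real))"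
proof -
  have "(\<integral>x. g x \<partial>atomic_measure X F w) = (\<integral>x. g (id x) \<partial>point_measure F (\<lambda>x. ennreal (w x)))"
    unfolding atomic_measure_def
    using assms(2,4) by (intro integral_distr measurable_restrict_space1)
      (auto simp: measurable_point_measure_eq1 space_restrict_space)
  also have "\<dots> = (\<Sum>x\<in>F. w x * g x)"
    using assms(1,3) by (simp add: lebesgue_integral_point_measure_finite)
  finally show ?thesis .
qed

lemma wprod_atomic_measure:
  assumes F: "finite F" "F \<subseteq> X" and v: "\<And>x. x \<in> F \<Longrightarrow> 0 \<le> v x" and w: "\<And>x. x \<in> F \<Longrightarrow> 0 \<le> w x"
  shows "wprod (atomic_measure X F v) (atomic_measure X F w) =
    (\<Sum>x\<in>F. \<Sum>y\<in>F. v x * w y * exp (- dist x y))"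
proof -
  have "(\<integral>y. exp (- dist x y) \<partial>atomic_measure X F w) = (\<Sum>y\<in>F. w y * exp (- dist x y))" for x
    by (intro integral_atomic_measure F w borel_measurable_continuous_onI continuous_intros)
  moreover have "(\<integral>x. (\<Sum>y\<in>F. w y * exp (- dist x y)) \<partial>atomic_measure X F v) =
      (\<Sum>x\<in>F. v x * (\<Sum>y\<in>F. w y * exp (- dist x y)))"
    by (intro integral_atomic_measure F v borel_measurable_continuous_onI continuous_intros)
  ultimately show ?thesis by (simp add: wprod_def sum_distrib_left mult_ac)
qed

text \<open>Dividing \<open>a\<close> by \<open>c\<close> gives mass 1 and energy 1 / c; the
  positive and negative parts of a / c serve as the two measures.\<close>

lemma magnitude_ge_weighting:
  assumes F: "finite F" "F \<subseteq> X" and a: "sum a F = c" "exp_energy F a = c" and c: "0 < c"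
  shows "ennreal c \<le> magnitude X"
proof -
  define p where "p u = max 0 (a u) / c" for u
  define n where "n u = max 0 (- a u) / c" for u
  define P where "P = atomic_measure X F p"
  define N where "N = atomic_measure X F n"
  have pn: "0 \<le> p u" "0 \<le> n u" "p u - n u = a u / c" for u
    using c by (auto simp: p_def n_def max_def)
  have borel: "finite_borel_on X P" "finite_borel_on X N"
    using F by (auto simp: P_def N_def intro: finite_borel_on_atomic_measure)
  have "wnorm2 P N = exp_energy F (\<lambda>u. p u - n u)"
    unfolding exp_energy_diff wnorm2_def P_def N_def using F pn by (simp add: wprod_atomic_measure)
  also have "\<dots> = exp_energy F a / c\<^sup>2"
    unfolding pn exp_energy_def by (simp add: sum_divide_distrib power2_eq_square)
  also have "\<dots> = 1 / c" using a c by (simp add: power2_eq_square)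
  finally have norm: "1 / wnorm2 P N = c" by simp
  have "measure P X = (\<Sum>u\<in>F. p u)" "measure N X = (\<Sum>u\<in>F. n u)"
    using integral_atomic_measure[OF F, of p "\<lambda>_. 1"] integral_atomic_measure[OF F, of n "\<lambda>_. 1"] pn
      finite_borel_onD(2)[OF borel(1)] finite_borel_onD(2)[OF borel(2)]
    by (simp_all add: P_def N_def)
  then have "measure P X - measure N X = sum a F / c"
    by (simp add: sum_subtractf [symmetric] pn sum_divide_distrib)
  then have "measure P X - measure N X = 1" using a c by simp
  then show ?thesis
    unfolding magnitude_def using borel norm
    by (intro SUP_upper2[of "(P, N)"]) auto
qed

section \<open>Magnitude\<close>

context R_tree
begin

lemma magnitude_le:
  assumes l: "total_length X = ennreal l" "0 \<le> l"
  shows "magnitude X \<le> ennreal (1 + l / 2)"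
  unfolding magnitude_def
proof (rule SUP_least, clarify)
  fix P N :: "'a measure"
  assume borel: "finite_borel_on X P" "finite_borel_on X N" and total: "measure P X - measure N X = 1"
  define W where "W = wnorm2 P N"
  define K where "K = (measure P X + measure N X)\<^sup>2"
  have approx: "1 \<le> (1 + l / 2) * (W + 2 * \<epsilon> * K)" if \<epsilon>: "0 < \<epsilon>" for \<epsilon>
  proof -
    obtain A where A: "finite A" "A \<subseteq> X" "X \<subseteq> (\<Union>x\<in>A. ball x \<epsilon>)"
      using compact_finite_net[OF compact \<epsilon>] by blast
    obtain T L where T: "subtree T L" "A \<subseteq> T" using subtree_containing_finite[OF A(1,2)] by blast
    \<comment> \<open>The upper estimate c \<le> 1 + L / 2 does not involve the mesh, so edges of
      length up to 1 suffice.\<close>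
    obtain F where F: "A \<inter> T \<subseteq> F" "finite_tree 1 F L"
      using subtree_finite_tree[OF T(1) A(1), of 1] by auto
    have L: "0 \<le> L" "L \<le> l" using subtree_length_nonneg subtree_length_le T l by fastforce+
    have net: "\<exists>u\<in>F. dist u x < \<epsilon>" if "x \<in> X" for x
      using A(3) that F(1) T(2) by fastforce
    then have "F \<noteq> {}" using nonempty by auto
    then obtain a where a: "sum a F = 1" "\<bar>W - exp_energy F a\<bar> \<le> 2 * \<epsilon> * K"
      using wnorm2_discretization[OF borel finite_tree_finite[OF F(2)] _ net] total
      by (auto simp: W_def K_def)
    obtain c where c: "c \<le> 1 + L / 2" "0 < c" "(sum a F)\<^sup>2 \<le> c * exp_energy F a"
      using finite_tree_weighting[OF F(2)] by blast
    have one_le: "1 \<le> c * exp_energy F a" using c(3) a(1) by simp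
    then have pos: "0 \<le> exp_energy F a"
      using c(2) by (metis linorder_not_le mult_pos_neg not_one_less_zero order.strict_trans1)
    have "c * exp_energy F a \<le> (1 + l / 2) * (W + 2 * \<epsilon> * K)"
      using c L a(2) pos by (intro mult_mono) auto
    with one_le show ?thesis by simp
  qed
  have "((\<lambda>\<epsilon>. (1 + l / 2) * (W + 2 * \<epsilon> * K)) \<longlongrightarrow> (1 + l / 2) * (W + 2 * 0 * K)) (at_right 0)"
    by (intro tendsto_intros)
  moreover have "eventually (\<lambda>\<epsilon>. 1 \<le> (1 + l / 2) * (W + 2 * \<epsilon> * K)) (at_right 0)"
    by (rule eventually_mono[OF eventually_at_right_less[of 0]]) (rule approx)
  ultimately have "1 \<le> (1 + l / 2) * (W + 2 * 0 * K)"
    by (rule tendsto_lowerbound) (rule trivial_limit_at_right_real)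
  then have ge: "1 \<le> (1 + l / 2) * W" by simp
  \<comment> \<open>Strict positivity of the norm is read off from the limit inequality; it permits
    the division by \<open>W\<close>.\<close>
  then have "0 < W" using l(2) by (smt (verit) mult_nonneg_nonpos divide_nonneg_pos)
  then have "1 / W \<le> 1 + l / 2" using ge by (simp add: divide_le_eq)
  then show "ennreal (1 / wnorm2 (fst (P, N)) (snd (P, N))) \<le> ennreal (1 + l / 2)"
    by (simp add: W_def ennreal_leI)
qed

lemma magnitude_ge_subtree:
  assumes "subtree T L"
  shows "ennreal (1 + L / 2) \<le> magnitude X"
proof -
  have *: "ennreal (1 + (1 - \<delta>) * L / 2) \<le> magnitude X" if "0 < \<delta>" for \<delta>
  proof -
    obtain F where F: "F \<subseteq> T" "finite_tree \<delta> F L"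
      using subtree_finite_tree[OF assms _ \<open>0 < \<delta>\<close>, of "{}"] by auto
    obtain c a where "1 + (1 - \<delta>) * L / 2 \<le> c" "0 < c" "sum a F = c" "exp_energy F a = c"
      using finite_tree_weighting[OF F(2)] by blast
    then show ?thesis
      using magnitude_ge_weighting[of F X a c] finite_tree_finite[OF F(2)] F(1) subtree_subset[OF assms]
      by (meson ennreal_leI order_trans)
  qed
  have "((\<lambda>\<delta>. ennreal (1 + (1 - \<delta>) * L / 2)) \<longlongrightarrow> ennreal (1 + (1 - 0) * L / 2)) (at_right 0)"
    by (intro tendsto_intros) auto
  moreover have "eventually (\<lambda>\<delta>. ennreal (1 + (1 - \<delta>) * L / 2) \<le> magnitude X) (at_right 0)"
    by (rule eventually_mono[OF eventually_at_right_less[of 0]]) (rule *)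
  ultimately have "ennreal (1 + (1 - 0) * L / 2) \<le> magnitude X"
    by (rule tendsto_upperbound) (rule trivial_limit_at_right_real)
  then show ?thesis by simp
qed

text \<open>For finite magnitude m the subtree bound is solved for the length: L \<le> 2 (m - 1) for
  all subtrees, hence also for the total length. A one-point subtree gives m \<ge> 1, so this bound
  is not truncated.\<close>

lemma magnitude_ge: "1 + total_length X / 2 \<le> magnitude X"
proof (cases "magnitude X")
  case (real m)
  obtain x where "x \<in> X" using nonempty by blast
  then have "ennreal (1 + 0 / 2) \<le> ennreal m" 
    unfolding real(2)[symmetric] by (intro magnitude_ge_subtree[of "{x}"] point)
  then have m: "1 \<le> m" using real(1) by (simp add: ennreal_le_iff2)
  have "total_length X \<le> ennreal (2 * (m - 1))"
  proof (rule total_length_le)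
    fix T L assume "subtree T L"
    then have "ennreal (1 + L / 2) \<le> ennreal m" "0 \<le> L"
      using magnitude_ge_subtree real(2) subtree_length_nonneg by auto
    then have "1 + L / 2 \<le> m" using real(1) ennreal_le_iff[of m "1 + L / 2"] by blast
    then show "ennreal L \<le> ennreal (2 * (m - 1))" by (intro ennreal_leI) simp
  qed
  then have "1 + total_length X / 2 \<le> 1 + ennreal (2 * (m - 1)) / 2"
    by (intro add_left_mono divide_right_mono_ennreal)
  also have "\<dots> = ennreal 1 + ennreal (2 * (m - 1) / 2)"
    using m divide_ennreal[of "2 * (m - 1)" 2] by simp
  also have "\<dots> = ennreal (1 + 2 * (m - 1) / 2)" using m by (intro ennreal_plus [symmetric]) auto
  also have "1 + 2 * (m - 1) / 2 = m" by (simp add: field_simps)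
  finally show ?thesis using real(2) by simp
qed simp

end

theorem theorem3p5:
  fixes X :: "'a::metric_space set"
  assumes "X \<noteq> {}" and "compact X" and "is_R_tree X"
  shows "magnitude X = 1 + total_length X / 2"
proof -
  interpret R_tree X using assms by unfold_locales
  show ?thesis
  proof (cases "total_length X")
    case (real l)
    have "ennreal (1 + l / 2) = 1 + total_length X / 2"
      using real divide_ennreal[of l 2] ennreal_plus[of 1 "l / 2"] by simp
    then show ?thesis using magnitude_le[OF real(2,1)] magnitude_ge by (simp add: antisym)
  next
    \<comment> \<open>For infinite length the lower bound alone forces infinite magnitude.\<close>
    case top
    then show ?thesis using magnitude_ge by (simp add: ennreal_top_divide top_unique)
  qed
qed

end
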